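(* Suppose there exists $\delta>0$ such that $a_*(t)\ge0$ for $0<t<\delta$, where $a_*(t)$ is the left end point of the free planar flow $\Lambda(t)$ starting from $\Lambda_0$. Then the interface evolution $\Gamma(t)$ of $V=-\kappa+A$ in $\mathbb{R}^2$ with initial data $\Gamma_0=\Lambda_0\cup\{(-x,y)\in\mathbb{R}^2\mid(x,y)\in\Lambda_0\}$ is fattening.
   Context: $A>0$ is a constant. $b_0>0$ and $u_0\in C[0,b_0]\cap C^\infty(0,b_0)$ satisfies $u_0>0$ on $(0,b_0)$, $u_0(0)=u_0(b_0)=0$, $u_0'(0)=-u_0'(b_0)=\infty$, and the curve $\Lambda_0=\{(x,y)\in\mathbb{R}^2\mid |y|=u_0(x),\ 0\le x\le b_0\}$ is a smooth closed curve. $V$ is the outer normal velocity and $\kappa$ the curvature (a circle of radius $R$ has $\kappa=1/R$). Extend $u_0$ evenly to $[-b_0,b_0]$; then $\Gamma_0=\{|y|=u_0(x)\}$. Free planar flow: the evolution of $\Lambda_0$ by $V=-\kappa+A$ in the whole plane is, for short time, $\Lambda(t)=\{|y|=v(x,t),\ a_*(t)\le x\le b_*(t)\}$, where $(v,a_*,b_* )$ solves $v_t=\frac{v_{xx}}{1+v_x^2}+A\sqrt{1+v_x^2}$ for $x\in(a_*(t),b_*(t))$, $v(a_*(t),t)=v(b_*(t),t)=0$, $v_x(a_*(t),t)=\infty$, $v_x(b_*(t),t)=-\infty$, $v(x,0)=u_0(x)$ on $[0,b_0]$. Level set evolution: the level set equation of $V=-\kappa+A$ in $\mathbb{R}^N$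 (here $N=2$) is $$\psi_t=|\nabla\psi|\,\mathrm{div}\Big(\frac{\nabla\psi}{|\nabla\psi|}\Big)+A|\nabla\psi|,$$ which has a unique viscosity solution for bounded uniformly continuous initial data. For a bounded open set $D_0$, the open evolution with initial data $D_0$ is $D(t)=\{\psi(\cdot,t)>0\}$, where $\psi$ is a viscosity solution with $D_0=\{\psi(\cdot,0)>0\}$. For a bounded closed set $E_0$, the closed evolution with initial data $E_0$ is $E(t)=\{\psi(\cdot,t)\ge0\}$, where $\psi$ is a viscosity solution with $E_0=\{\psi(\cdot,0)\ge0\}$. (These do not depend on the choice of $\psi(\cdot,0)$; e.g. $\psi(\cdot,0)=\max\{\mathrm{sd}(\cdot,\partial D_0),-1\}$ with $\mathrm{sd}$ the signed distance, positive in $D_0$.) The set $E(t)\setminus D(t)$ is the interface evolution with initial data $E_0\setminus D_0$. Here $D_0=\{(x,y)\mid|y|<u_0(x),\ -b_0\le x\le b_0\}$ and $E_0=\overline{D_0}$, so $E_0\setminus D_0=\Gamma_0$. The interface evolution is called fattening if $E(t)\setminus D(t)$ has interior points for some $t$. *)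

theory Defs
  imports "HOL-Analysis.Analysis"
begin

section \<open>Viscosity solutions of the level set equation\<close>

text \<open>
  For \<open>p = \<nabla>\<psi> \<noteq> 0\<close> and \<open>X = \<nabla>\<^sup>2\<psi>\<close> one has
  \<open>|\<nabla>\<psi>| div (\<nabla>\<psi> / |\<nabla>\<psi>|) = trace ((I - p p\<^sup>T / |p|\<^sup>2) X)\<close>,
  so \<open>level_set_op A p X\<close> is the right-hand side of the level set equation of \<open>V = -\<kappa> + A\<close>.
  It is singular at \<open>p = 0\<close>; viscosity solutions are defined through its semicontinuous
  envelopes, taken over nonzero vectors and symmetric matrices.
\<close>

definition level_set_op :: "real \<Rightarrow> real^'n \<Rightarrow> real^'n^'n \<Rightarrow> real" where
  "level_set_op A p X =
     trace ((mat 1 - (1 / (norm p)\<^sup>2) *\<^sub>R (\<chi> i j. p $ i * p $ j)) ** X) + A * norm p"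

definition op_domain :: "((real^'n) \<times> (real^'n^'n)) set" where
  "op_domain = {(q, Y). q \<noteq> 0 \<and> transpose Y = Y}"

definition upper_op :: "real \<Rightarrow> real^'n \<Rightarrow> real^'n^'n \<Rightarrow> ereal" where
  "upper_op A p X =
     Limsup (inf (nhds (p, X)) (principal op_domain)) (\<lambda>(q, Y). ereal (level_set_op A q Y))"

definition lower_op :: "real \<Rightarrow> real^'n \<Rightarrow> real^'n^'n \<Rightarrow> ereal" where
  "lower_op A p X =
     Liminf (inf (nhds (p, X)) (principal op_domain)) (\<lambda>(q, Y). ereal (level_set_op A q Y))"

text \<open>
  \<open>\<phi>\<close> is a function of class \<open>C\<^sup>2\<^sup>,\<^sup>1\<close> on \<open>\<real>\<^sup>N \<times> (0, \<infinity>)\<close> with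
  time derivative \<open>\<phi>t\<close>, spatial gradient \<open>g\<close> and spatial Hessian \<open>H\<close>.
\<close>

definition test_function ::
  "(real^'n \<Rightarrow> real \<Rightarrow> real) \<Rightarrow> (real^'n \<Rightarrow> real \<Rightarrow> real) \<Rightarrow> (real^'n \<Rightarrow> real \<Rightarrow> real^'n)
     \<Rightarrow> (real^'n \<Rightarrow> real \<Rightarrow> real^'n^'n) \<Rightarrow> bool" where
  "test_function \<phi> \<phi>t g H \<longleftrightarrow>
     (\<forall>x. \<forall>t>0.
        ((\<lambda>z. \<phi> (fst z) (snd z)) has_derivative (\<lambda>h. g x t \<bullet> fst h + \<phi>t x t * snd h)) (at (x, t)) \<and>
        ((\<lambda>y. g y t) has_derivative (\<lambda>h. H x t *v h)) (at x)) \<and>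
     continuous_on (UNIV \<times> {0<..}) (\<lambda>z. \<phi>t (fst z) (snd z)) \<and>
     continuous_on (UNIV \<times> {0<..}) (\<lambda>z. g (fst z) (snd z)) \<and>
     continuous_on (UNIV \<times> {0<..}) (\<lambda>z. H (fst z) (snd z))"

definition viscosity_subsolution :: "real \<Rightarrow> (real^'n \<Rightarrow> real \<Rightarrow> real) \<Rightarrow> bool" where
  "viscosity_subsolution A \<psi> \<longleftrightarrow>
     (\<forall>\<phi> \<phi>t g H. test_function \<phi> \<phi>t g H \<longrightarrow>
        (\<forall>x. \<forall>t>0.
           (\<forall>\<^sub>F z in nhds (x, t). \<psi> (fst z) (snd z) - \<phi> (fst z) (snd z) \<le> \<psi> x t - \<phi> x t) \<longrightarrow>
           ereal (\<phi>t x t) \<le> upper_op A (g x t) (H x t)))"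

definition viscosity_supersolution :: "real \<Rightarrow> (real^'n \<Rightarrow> real \<Rightarrow> real) \<Rightarrow> bool" where
  "viscosity_supersolution A \<psi> \<longleftrightarrow>
     (\<forall>\<phi> \<phi>t g H. test_function \<phi> \<phi>t g H \<longrightarrow>
        (\<forall>x. \<forall>t>0.
           (\<forall>\<^sub>F z in nhds (x, t). \<psi> (fst z) (snd z) - \<phi> (fst z) (snd z) \<ge> \<psi> x t - \<phi> x t) \<longrightarrow>
           ereal (\<phi>t x t) \<ge> lower_op A (g x t) (H x t)))"

text \<open>
  Solutions on \<open>\<real>\<^sup>N \<times> [0, \<infinity>)\<close> with bounded uniformly continuous initial data, in the
  class of continuous functions that are bounded on every \<open>\<real>\<^sup>N \<times> [0, S]\<close>, in which the
  solution is determined by its initial data.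
\<close>

definition viscosity_solution :: "real \<Rightarrow> (real^'n \<Rightarrow> real \<Rightarrow> real) \<Rightarrow> bool" where
  "viscosity_solution A \<psi> \<longleftrightarrow>
     continuous_on (UNIV \<times> {0..}) (\<lambda>z. \<psi> (fst z) (snd z)) \<and>
     (\<forall>S. bounded ((\<lambda>z. \<psi> (fst z) (snd z)) ` (UNIV \<times> {0..S}))) \<and>
     uniformly_continuous_on UNIV (\<lambda>x. \<psi> x 0) \<and>
     viscosity_subsolution A \<psi> \<and> viscosity_supersolution A \<psi>"

section \<open>Open, closed and interface evolutions\<close>

definition open_evolution :: "real \<Rightarrow> (real^'n) set \<Rightarrow> (real \<Rightarrow> (real^'n) set) \<Rightarrow> bool" where
  "open_evolution A D0 D \<longleftrightarrow>
     (\<exists>\<psi>. viscosity_solution A \<psi> \<and> D0 = {x. \<psi> x 0 > 0} \<and> (\<forall>t\<ge>0. D t = {x. \<psi> x t > 0}))"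

definition closed_evolution :: "real \<Rightarrow> (real^'n) set \<Rightarrow> (real \<Rightarrow> (real^'n) set) \<Rightarrow> bool" where
  "closed_evolution A E0 E \<longleftrightarrow>
     (\<exists>\<psi>. viscosity_solution A \<psi> \<and> E0 = {x. \<psi> x 0 \<ge> 0} \<and> (\<forall>t\<ge>0. E t = {x. \<psi> x t \<ge> 0}))"

text \<open>The interface evolution with initial data \<open>E0 - D0\<close>.\<close>

definition interface_evolution ::
  "real \<Rightarrow> (real^'n) set \<Rightarrow> (real^'n) set \<Rightarrow> (real \<Rightarrow> (real^'n) set) \<Rightarrow> bool" where
  "interface_evolution A D0 E0 \<Gamma> \<longleftrightarrow>
     (\<exists>D E. open_evolution A D0 D \<and> closed_evolution A E0 E \<and> (\<forall>t\<ge>0. \<Gamma> t = E t - D t))"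

definition fattening :: "(real \<Rightarrow> (real^'n) set) \<Rightarrow> bool" where
  "fattening \<Gamma> \<longleftrightarrow> (\<exists>t\<ge>0. interior (\<Gamma> t) \<noteq> {})"

section \<open>Plane curves and their classical evolution\<close>

definition smooth_on :: "real set \<Rightarrow> (real \<Rightarrow> real) \<Rightarrow> bool" where
  "smooth_on S f \<longleftrightarrow> (\<forall>n. \<forall>x\<in>S. (deriv ^^ n) f differentiable (at x))"

definition smooth_closed_curve :: "(real^2) set \<Rightarrow> bool" where
  "smooth_closed_curve C \<longleftrightarrow>
     (\<exists>\<gamma> :: real \<Rightarrow> real^2.
        (\<forall>i. smooth_on UNIV (\<lambda>s. \<gamma> s $ i)) \<and>
        (\<forall>s. vector_derivative \<gamma> (at s) \<noteq> 0) \<and>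
        (\<forall>s. \<gamma> (s + 1) = \<gamma> s) \<and> inj_on \<gamma> {0..<1} \<and> C = range \<gamma>)"

text \<open>\<open>n\<close> is the outer unit normal at \<open>p\<close> of the Jordan curve \<open>C\<close> with tangent vector \<open>\<tau>\<close> at \<open>p\<close>.\<close>

definition outer_normal :: "(real^2) set \<Rightarrow> real^2 \<Rightarrow> real^2 \<Rightarrow> real^2 \<Rightarrow> bool" where
  "outer_normal C p \<tau> n \<longleftrightarrow>
     norm n = 1 \<and> n \<bullet> \<tau> = 0 \<and> (\<forall>\<^sub>F \<epsilon> in at_right 0. p + \<epsilon> *\<^sub>R n \<in> outside C)"

text \<open>
  Classical evolution of closed embedded curves by \<open>V = -\<kappa> + A\<close> on \<open>[0, T)\<close>, of class
  \<open>C\<^sup>2\<^sup>,\<^sup>1\<close> up to \<open>t = 0\<close>. The curvature with respect to the outer normal \<open>n\<close> is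
  \<open>\<kappa> = - (\<gamma>\<^sub>s\<^sub>s \<bullet> n) / |\<gamma>\<^sub>s|\<^sup>2\<close>, which is \<open>1/R\<close> for a circle of radius \<open>R\<close>;
  the outer normal velocity is \<open>V = \<gamma>\<^sub>t \<bullet> n\<close>.
\<close>

definition classical_evolution :: "real \<Rightarrow> real \<Rightarrow> (real \<Rightarrow> (real^2) set) \<Rightarrow> bool" where
  "classical_evolution A T \<Lambda> \<longleftrightarrow>
     (\<exists>(\<gamma> :: real \<Rightarrow> real \<Rightarrow> real^2) \<gamma>s \<gamma>ss \<gamma>t.
        (\<forall>s. \<forall>t\<in>{0..<T}.
           ((\<lambda>r. \<gamma> r t) has_vector_derivative \<gamma>s s t) (at s) \<and>
           ((\<lambda>r. \<gamma>s r t) has_vector_derivative \<gamma>ss s t) (at s) \<and>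
           ((\<lambda>r. \<gamma> s r) has_vector_derivative \<gamma>t s t) (at t within {0..<T})) \<and>
        continuous_on (UNIV \<times> {0..<T}) (\<lambda>z. \<gamma> (fst z) (snd z)) \<and>
        continuous_on (UNIV \<times> {0..<T}) (\<lambda>z. \<gamma>s (fst z) (snd z)) \<and>
        continuous_on (UNIV \<times> {0..<T}) (\<lambda>z. \<gamma>ss (fst z) (snd z)) \<and>
        continuous_on (UNIV \<times> {0..<T}) (\<lambda>z. \<gamma>t (fst z) (snd z)) \<and>
        (\<forall>t\<in>{0..<T}.
           (\<forall>s. \<gamma> (s + 1) t = \<gamma> s t) \<and> inj_on (\<lambda>s. \<gamma> s t) {0..<1} \<and>
           (\<forall>s. \<gamma>s s t \<noteq> 0) \<and> \<Lambda> t = range (\<lambda>s. \<gamma> s t) \<and>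
           (\<forall>s. \<exists>n. outer_normal (\<Lambda> t) (\<gamma> s t) (\<gamma>s s t) n \<and>
              (let \<kappa> = - (\<gamma>ss s t \<bullet> n) / (norm (\<gamma>s s t))\<^sup>2 in \<gamma>t s t \<bullet> n = - \<kappa> + A))))"

section \<open>The initial curve and the free planar flow\<close>

definition graph_curve :: "real \<Rightarrow> real \<Rightarrow> (real \<Rightarrow> real) \<Rightarrow> (real^2) set" where
  "graph_curve a b u = {z. a \<le> z $ 1 \<and> z $ 1 \<le> b \<and> \<bar>z $ 2\<bar> = u (z $ 1)}"

definition vertical_ends :: "real \<Rightarrow> real \<Rightarrow> (real \<Rightarrow> real) \<Rightarrow> bool" where
  "vertical_ends a b u \<longleftrightarrow>
     filterlim (\<lambda>x. (u x - u a) / (x - a)) at_top (at_right a) \<and>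
     filterlim (\<lambda>x. (u x - u b) / (x - b)) at_bot (at_left b)"

definition initial_profile :: "real \<Rightarrow> (real \<Rightarrow> real) \<Rightarrow> bool" where
  "initial_profile b0 u0 \<longleftrightarrow>
     0 < b0 \<and> continuous_on {0..b0} u0 \<and> smooth_on {0<..<b0} u0 \<and>
     (\<forall>x\<in>{0<..<b0}. 0 < u0 x) \<and> u0 0 = 0 \<and> u0 b0 = 0 \<and>
     vertical_ends 0 b0 u0 \<and> smooth_closed_curve (graph_curve 0 b0 u0)"

text \<open>
  The evolution of \<open>graph_curve 0 b0 u0\<close> by \<open>V = -\<kappa> + A\<close> in the whole plane on \<open>[0, T)\<close>,
  represented as \<open>\<Lambda>(t) = {|y| = v(x,t), a t \<le> x \<le> b t}\<close>.
\<close>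

definition free_planar_flow ::
  "real \<Rightarrow> real \<Rightarrow> (real \<Rightarrow> real) \<Rightarrow> real \<Rightarrow> (real \<Rightarrow> real \<Rightarrow> real) \<Rightarrow> (real \<Rightarrow> real) \<Rightarrow> (real \<Rightarrow> real) \<Rightarrow> bool"
where
  "free_planar_flow A b0 u0 T v a b \<longleftrightarrow>
     0 < T \<and> a 0 = 0 \<and> b 0 = b0 \<and> (\<forall>x\<in>{0..b0}. v x 0 = u0 x) \<and>
     continuous_on {0..<T} a \<and> continuous_on {0..<T} b \<and>
     continuous_on {(x, t). t \<in> {0..<T} \<and> x \<in> {a t..b t}} (\<lambda>z. v (fst z) (snd z)) \<and>
     (\<forall>t\<in>{0..<T}. a t < b t \<and> v (a t) t = 0 \<and> v (b t) t = 0 \<and>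
        vertical_ends (a t) (b t) (\<lambda>x. v x t) \<and> (\<forall>x\<in>{a t<..<b t}. 0 < v x t)) \<and>
     (\<exists>vx vxx vt.
        (\<forall>t\<in>{0<..<T}. \<forall>x\<in>{a t<..<b t}.
           ((\<lambda>y. v y t) has_real_derivative vx x t) (at x) \<and>
           ((\<lambda>y. vx y t) has_real_derivative vxx x t) (at x) \<and>
           ((\<lambda>s. v x s) has_real_derivative vt x t) (at t) \<and>
           vt x t = vxx x t / (1 + (vx x t)\<^sup>2) + A * sqrt (1 + (vx x t)\<^sup>2))) \<and>
     classical_evolution A T (\<lambda>t. graph_curve (a t) (b t) (\<lambda>x. v x t))"

text \<open>The open set enclosed by \<open>\<Gamma>\<^sub>0\<close>, with \<open>u0\<close> extended evenly to \<open>[-b0, b0]\<close>.\<close>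

definition D_init :: "real \<Rightarrow> (real \<Rightarrow> real) \<Rightarrow> (real^2) set" where
  "D_init b0 u0 = {z. \<bar>z $ 2\<bar> < u0 \<bar>z $ 1\<bar> \<and> - b0 \<le> z $ 1 \<and> z $ 1 \<le> b0}"

definition E_init :: "real \<Rightarrow> (real \<Rightarrow> real) \<Rightarrow> (real^2) set" where
  "E_init b0 u0 = closure (D_init b0 u0)"

lemma E_init_eq:
  assumes "initial_profile b0 u0"
  shows "E_init b0 u0 = {z. \<bar>z $ 2\<bar> \<le> u0 \<bar>z $ 1\<bar> \<and> \<bar>z $ 1\<bar> \<le> b0}" (is "_ = ?K")
proof
  have b0: "0 < b0" and cont: "continuous_on {0..b0} u0" and pos: "\<And>x. 0 < x \<Longrightarrow> x < b0 \<Longrightarrow> 0 < u0 x"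
    and ends: "u0 0 = 0" "u0 b0 = 0"
    using assms by (auto simp: initial_profile_def)
  let ?S = "{z :: real^2. \<bar>z $ 1\<bar> \<le> b0}"
  have "closed ?S"
    by (intro closed_Collect_le continuous_intros)
  moreover have "continuous_on ?S (\<lambda>z. u0 \<bar>z $ 1\<bar> - \<bar>z $ 2\<bar>)"
    by (intro continuous_intros continuous_on_compose2[OF cont]) auto
  ultimately have "closed (?S \<inter> (\<lambda>z. u0 \<bar>z $ 1\<bar> - \<bar>z $ 2\<bar>) -` {0..})"
    by (intro continuous_closed_preimage closed_atLeast)
  also have "?S \<inter> (\<lambda>z. u0 \<bar>z $ 1\<bar> - \<bar>z $ 2\<bar>) -` {0..} = ?K"
    by auto
  finally show "E_init b0 u0 \<subseteq> ?K"
    unfolding E_init_def by (intro closure_minimal) (auto simp: D_init_def)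
  show "?K \<subseteq> E_init b0 u0"
  proof
    fix z assume "z \<in> ?K"
    then have z: "\<bar>z $ 2\<bar> \<le> u0 \<bar>z $ 1\<bar>" "\<bar>z $ 1\<bar> \<le> b0" by auto
    have lim: "z \<in> E_init b0 u0"
      if d: "\<And>e. 0 < e \<Longrightarrow> e < min 1 b0 \<Longrightarrow> z + e *\<^sub>R d \<in> D_init b0 u0" for d
    proof -
      have "\<forall>\<^sub>F e in at_right 0. z + e *\<^sub>R d \<in> D_init b0 u0"
        unfolding eventually_at_right_field using d b0 by (intro exI[of _ "min 1 b0"]) auto
      then have "\<forall>\<^sub>F e in at_right 0. z + e *\<^sub>R d \<in> closure (D_init b0 u0)"
        by (rule eventually_mono) (use closure_subset in blast)
      moreover have "((\<lambda>e. z + e *\<^sub>R d) \<longlongrightarrow> z) (at_right (0::real))"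
        by (auto intro!: tendsto_eq_intros)
      ultimately have "z \<in> closure (D_init b0 u0)"
        by (intro Lim_in_closed_set[of _ _ "at_right (0::real)"]) auto
      then show ?thesis by (simp add: E_init_def)
    qed
    consider "0 < \<bar>z $ 1\<bar>" "\<bar>z $ 1\<bar> < b0" | "z $ 1 = 0" | "z $ 1 = b0" | "z $ 1 = - b0"
      using z by fastforce
    then show "z \<in> E_init b0 u0"
    proof cases
      case 1
      show ?thesis
      proof (rule lim[where d = "vector [0, - z $ 2]"])
        fix e :: real assume e: "0 < e" "e < min 1 b0"
        have "\<bar>z $ 2 - e * z $ 2\<bar> = (1 - e) * \<bar>z $ 2\<bar>"
          using e abs_mult[of "1 - e" "z $ 2"] by (simp add: left_diff_distrib)
        also have "\<dots> < u0 \<bar>z $ 1\<bar>"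
        proof (cases "z $ 2 = 0")
          case False
          then have "(1 - e) * \<bar>z $ 2\<bar> < 1 * \<bar>z $ 2\<bar>"
            using e by (intro mult_strict_right_mono) auto
          then show ?thesis using z by linarith
        qed (use pos 1 in auto)
        finally show "z + e *\<^sub>R vector [0, - z $ 2] \<in> D_init b0 u0"
          using z by (auto simp: D_init_def)
      qed
    next
      case 2
      then show ?thesis
        using z ends by (intro lim[where d = "vector [1, 0]"]) (auto simp: D_init_def pos)
    next
      case 3
      then show ?thesis
        using z ends b0 by (intro lim[where d = "vector [-1, 0]"]) (auto simp: D_init_def pos)
    next
      case 4
      then have "\<bar>- b0 + e\<bar> = b0 - e" if "e < b0" for e
        using that by auto
      then show ?thesis
        using 4 z ends b0 by (intro lim[where d = "vector [1, 0]"]) (auto simp: D_init_def pos)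
    qed
  qed
qed

lemma initial_interface_eq:
  assumes "initial_profile b0 u0"
  shows "E_init b0 u0 - D_init b0 u0 =
    graph_curve 0 b0 u0 \<union> (\<lambda>z. vector [- z $ 1, z $ 2]) ` graph_curve 0 b0 u0" (is "?L = ?C \<union> ?R")
proof -
  have R: "?R = {z. - b0 \<le> z $ 1 \<and> z $ 1 \<le> 0 \<and> \<bar>z $ 2\<bar> = u0 (- z $ 1)}" (is "_ = ?R'")
  proof (intro equalityI subsetI)
    fix z assume "z \<in> ?R'"
    moreover have "z = vector [- (vector [- z $ 1, z $ 2] :: real^2) $ 1, (vector [- z $ 1, z $ 2] :: real^2) $ 2]"
      by (simp add: vec_eq_iff forall_2)
    ultimately show "z \<in> ?R"
      by (intro image_eqI[of _ _ "vector [- z $ 1, z $ 2]"]) (auto simp: graph_curve_def)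
  qed (auto simp: graph_curve_def)
  show ?thesis
    unfolding R E_init_eq[OF assms] unfolding D_init_def graph_curve_def
  proof (intro equalityI subsetI)
    fix z :: "real^2"
    assume "z \<in> {z. \<bar>z $ 2\<bar> \<le> u0 \<bar>z $ 1\<bar> \<and> \<bar>z $ 1\<bar> \<le> b0} -
      {z. \<bar>z $ 2\<bar> < u0 \<bar>z $ 1\<bar> \<and> - b0 \<le> z $ 1 \<and> z $ 1 \<le> b0}"
    then have "\<bar>z $ 2\<bar> = u0 \<bar>z $ 1\<bar>" "\<bar>z $ 1\<bar> \<le> b0" by auto
    then show "z \<in> {z. 0 \<le> z $ 1 \<and> z $ 1 \<le> b0 \<and> \<bar>z $ 2\<bar> = u0 (z $ 1)} \<union>
      {z. - b0 \<le> z $ 1 \<and> z $ 1 \<le> 0 \<and> \<bar>z $ 2\<bar> = u0 (- z $ 1)}"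
      by (cases "0 \<le> z $ 1") auto
  next
    fix z :: "real^2"
    assume "z \<in> {z. 0 \<le> z $ 1 \<and> z $ 1 \<le> b0 \<and> \<bar>z $ 2\<bar> = u0 (z $ 1)} \<union>
      {z. - b0 \<le> z $ 1 \<and> z $ 1 \<le> 0 \<and> \<bar>z $ 2\<bar> = u0 (- z $ 1)}"
    then have "\<bar>z $ 2\<bar> = u0 \<bar>z $ 1\<bar>" "\<bar>z $ 1\<bar> \<le> b0" by auto
    then show "z \<in> {z. \<bar>z $ 2\<bar> \<le> u0 \<bar>z $ 1\<bar> \<and> \<bar>z $ 1\<bar> \<le> b0} -
      {z. \<bar>z $ 2\<bar> < u0 \<bar>z $ 1\<bar> \<and> - b0 \<le> z $ 1 \<and> z $ 1 \<le> b0}"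
      by auto
  qed
qed

end

theory Submission
  imports Defs
begin

text \<open>
  Viscosity solutions are only compared with smooth barriers, so no comparison principle between
  two viscosity solutions is needed.

  Near the origin \<open>E\<^sub>0\<close> contains the cones \<open>|y| \<le> |x|\<close>. Since \<open>A > 0\<close>, the sets
  \<open>{y\<^sup>2 \<le> x\<^sup>2 + A t\<^sup>3\<^sup>/\<^sup>2}\<close> move more slowly than \<open>V = -\<kappa> + A\<close>, hence \<open>E(t)\<close> contains a
  neighbourhood of the origin for small \<open>t > 0\<close>.

  Let \<open>O(t)\<close> be the open set enclosed by \<open>\<Lambda>(t)\<close> and its mirror image; because of \<open>a\<^sub>* \<ge> 0\<close>
  the two halves are disjoint. If \<open>\<psi>\<close> defines \<open>D(t)\<close>, then for every \<open>\<eta> > 0\<close> and suitable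
  \<open>C\<close> one has \<open>\<psi>(x,t) \<le> C |x - q|\<^sup>4 + \<eta> / (\<delta> - t)\<close> whenever \<open>q \<notin> O(t)\<close>. Indeed, at a positive
  maximum of the difference the point \<open>q\<close> lies on \<open>\<Lambda>(t)\<close> or its mirror image, and letting \<open>q\<close>
  move along this curve produces a test function whose level line through \<open>x\<close> is to second order
  a translate of the curve; it therefore moves by the same law and contradicts \<open>\<eta> > 0\<close>.
  With \<open>q = x\<close> this gives \<open>D(t) \<subseteq> O(t)\<close>. So the points \<open>(0,y)\<close> with small \<open>y \<noteq> 0\<close> are interior
  points of \<open>E(t) - D(t)\<close>.
\<close>

section \<open>The level set operator and its envelopes\<close>

definition outer_prod :: "real^'n \<Rightarrow> real^'n \<Rightarrow> real^'n^'n" where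
  "outer_prod a b = (\<chi> i j. a $ i * b $ j)"

lemma outer_prod_mult_vec: "outer_prod a b *v h = (b \<bullet> h) *\<^sub>R a"
  by (simp add: outer_prod_def matrix_vector_mult_def vec_eq_iff inner_vec_def
      sum_distrib_right sum_distrib_left mult_ac)

lemma trace_outer_prod: "trace (outer_prod a b) = a \<bullet> b"
  by (simp add: outer_prod_def trace_def inner_vec_def)

lemma trace_scaleR: "trace (c *\<^sub>R M) = c * trace (M :: real^'n^'n)"
  by (simp add: trace_def sum_distrib_left)

lemma outer_prod_0 [simp]: "outer_prod 0 b = 0" "outer_prod a 0 = 0"
  by (simp_all add: outer_prod_def vec_eq_iff)

text \<open>The curvature part is the trace of \<open>X\<close> minus its quadratic form in the
  direction of \<open>p\<close>, which is easier to evaluate than a matrix product. At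
  \<open>p = 0\<close> both sides read division by zero as 0 and equal
  \<open>trace X\<close>.\<close>

lemma level_set_op_eq:
  "level_set_op A p X = trace X - (p \<bullet> (X *v p)) / (norm p)\<^sup>2 + A * norm p"
proof -
  have "trace ((mat 1 - (1 / (norm p)\<^sup>2) *\<^sub>R (\<chi> i j. p $ i * p $ j)) ** X)
      = trace X - (1 / (norm p)\<^sup>2) * (\<Sum>i\<in>UNIV. \<Sum>k\<in>UNIV. (p $ i * p $ k) * X $ k $ i)"
    by (simp add: trace_def matrix_matrix_mult_def left_diff_distrib sum_subtractf mat_def
        sum_distrib_left mult.assoc if_distrib[of "\<lambda>x. x * _"] cong: if_cong)
  also have "(\<Sum>i\<in>UNIV. \<Sum>k\<in>UNIV. (p $ i * p $ k) * X $ k $ i) = p \<bullet> (X *v p)"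
    unfolding inner_vec_def matrix_vector_mult_def
    by (subst sum.swap) (simp add: sum_distrib_left mult_ac)
  finally show ?thesis by (simp add: level_set_op_def)
qed

lemma matrix_vec_scaleR: "((c *\<^sub>R X) :: real^'n^'m) *v p = c *\<^sub>R (X *v p)"
  by (simp add: matrix_vector_mult_def vec_eq_iff sum_distrib_left mult_ac)

text \<open>The projection orthogonal to \<open>p\<close> annihilates p p^T, and what remains is
  homogeneous of degree one. With the chain rule this says that the operator at F(U) is F'(U) times
  the operator at U, so the law sees level lines only.\<close>

lemma level_set_op_geometric:
  assumes "0 < l" "p \<noteq> 0"
  shows "level_set_op A (l *\<^sub>R p) (l *\<^sub>R X + m *\<^sub>R outer_prod p p) = l * level_set_op A p X"
proof -
  define N where "N = norm p"
  have N: "p \<bullet> p = N\<^sup>2" "0 < N"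
    using assms by (simp_all add: N_def power2_norm_eq_inner)
  have "trace (l *\<^sub>R X + m *\<^sub>R outer_prod p p) = l * trace X + m * N\<^sup>2"
    by (simp add: trace_add trace_scaleR trace_outer_prod N)
  moreover have "(l *\<^sub>R p) \<bullet> ((l *\<^sub>R X + m *\<^sub>R outer_prod p p) *v (l *\<^sub>R p))
      = l\<^sup>2 * (l * (p \<bullet> (X *v p)) + m * N^4)"
    by (simp add: matrix_vector_mult_add_rdistrib matrix_vec_scaleR outer_prod_mult_vec
        inner_add_right matrix_vector_mult_scaleR N power2_eq_square power4_eq_xxxx algebra_simps)
  ultimately show ?thesis
    using assms(1) N(2) unfolding level_set_op_eq norm_scaleR N_def[symmetric]
    by (simp add: field_simps power2_eq_square power4_eq_xxxx)
qed

lemma norm_matrix_component: "\<bar>(Y :: real^'n^'m) $ i $ j\<bar> \<le> norm Y"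
  by (metis Finite_Cartesian_Product.norm_nth_le order_trans real_norm_def)

lemma norm_matrix_vec_le:
  "norm ((Y :: real^'n^'n) *v p) \<le> (real CARD('n))\<^sup>2 * norm Y * norm p"
proof -
  have "norm (Y *v p) \<le> (\<Sum>i\<in>UNIV. \<bar>(Y *v p) $ i\<bar>)"
    by (rule norm_le_l1_cart)
  also have "\<dots> \<le> (\<Sum>i\<in>(UNIV::'n set). \<Sum>j\<in>(UNIV::'n set). norm Y * norm p)"
    unfolding matrix_vector_mult_def vec_lambda_beta
    by (intro sum_mono order_trans[OF sum_abs])
       (auto intro!: sum_mono mult_mono norm_matrix_component component_le_norm_cart simp: abs_mult simp del: sum_constant)
  also have "\<dots> = (real CARD('n))\<^sup>2 * norm Y * norm p"
    by (simp add: power2_eq_square)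
  finally show ?thesis .
qed

text \<open>Cauchy-Schwarz controls the singular quotient uniformly in the direction of
  \<open>p\<close>. Hence the operator is bounded above near (0, 0) by a quantity tending to
  0.\<close>

lemma level_set_op_bound:
  fixes p :: "real^'n"
  shows "level_set_op A p X \<le> (real CARD('n) + (real CARD('n))\<^sup>2) * norm X + \<bar>A\<bar> * norm p"
proof -
  have "trace X \<le> (\<Sum>i\<in>(UNIV::'n set). norm X)"
    unfolding trace_def by (intro sum_mono) (use norm_matrix_component abs_le_D1 in blast)
  then have 1: "trace X \<le> real CARD('n) * norm X" by simp
  have 2: "- (p \<bullet> (X *v p)) / (norm p)\<^sup>2 \<le> (real CARD('n))\<^sup>2 * norm X"
  proof (cases "p = 0")
    case False
    have "- (p \<bullet> (X *v p)) \<le> norm p * norm (X *v p)"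
      using Cauchy_Schwarz_ineq2[of p "X *v p"] by linarith
    also have "\<dots> \<le> norm p * ((real CARD('n))\<^sup>2 * norm X * norm p)"
      by (intro mult_left_mono norm_matrix_vec_le) auto
    finally show ?thesis using False by (simp add: field_simps power2_eq_square)
  qed simp
  have "A * norm p \<le> \<bar>A\<bar> * norm p" by (simp add: mult_right_mono)
  with 1 2 show ?thesis by (simp add: level_set_op_eq algebra_simps)
qed

lemma upper_op_zero: "upper_op A 0 (0 :: real^'n^'n) \<le> 0"
  unfolding upper_op_def Limsup_le_iff
proof (intro allI impI)
  fix y :: ereal assume "0 < y"
  let ?b = "\<lambda>z :: (real^'n) \<times> (real^'n^'n).
    (real CARD('n) + (real CARD('n))\<^sup>2) * norm (snd z) + \<bar>A\<bar> * norm (fst z)"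
  have "(?b \<longlongrightarrow> ?b (0, 0)) (nhds (0, 0))"
    by (intro tendsto_intros tendsto_fst[OF filterlim_ident] tendsto_snd[OF filterlim_ident])
  then have "((\<lambda>z. ereal (?b z)) \<longlongrightarrow> 0) (nhds (0, 0))"
    by (simp add: zero_ereal_def)
  then have "\<forall>\<^sub>F z in nhds (0, 0). ereal (?b z) < y"
    by (rule order_tendstoD) fact
  then have "\<forall>\<^sub>F z in nhds (0, 0). (case z of (q :: real^'n, Y) \<Rightarrow> ereal (level_set_op A q Y)) < y"
  proof (rule eventually_mono)
    fix z assume "ereal (?b z) < y"
    then show "(case z of (q, Y) \<Rightarrow> ereal (level_set_op A q Y)) < y"
      using level_set_op_bound[of A "fst z" "snd z"] ereal_less_eq(3) le_less_trans
      by (metis (no_types, lifting) case_prod_beta)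
  qed
  then show "\<forall>\<^sub>F z in inf (nhds (0, 0)) (principal op_domain).
      (case z of (q :: real^'n, Y) \<Rightarrow> ereal (level_set_op A q Y)) < y"
    by (simp add: eventually_inf_principal eventually_mono)
qed

text \<open>Away from \<open>p = 0\<close> the operator is continuous, so its upper envelope does
  not exceed its value.\<close>

lemma upper_op_le:
  assumes "p \<noteq> 0"
  shows "upper_op A p X \<le> ereal (level_set_op A p X)"
  unfolding upper_op_def Limsup_le_iff
proof (intro allI impI)
  fix y :: ereal assume y: "ereal (level_set_op A p X) < y"
  have nz: "(norm p)\<^sup>2 \<noteq> 0" using assms by simp
  have fst: "(fst \<longlongrightarrow> p) (nhds (p, X))" and snd: "(snd \<longlongrightarrow> X) (nhds (p, X))"
    using tendsto_fst[OF filterlim_ident[of "nhds (p, X)"]]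
      tendsto_snd[OF filterlim_ident[of "nhds (p, X)"]] by (simp_all add: o_def)
  have "((\<lambda>z. level_set_op A (fst z) (snd z)) \<longlongrightarrow> level_set_op A p X) (nhds (p, X))"
    unfolding level_set_op_eq trace_def inner_vec_def matrix_vector_mult_def vec_lambda_beta
    by (intro tendsto_intros fst snd nz tendsto_vec_nth)
  then have "((\<lambda>z. ereal (level_set_op A (fst z) (snd z))) \<longlongrightarrow> ereal (level_set_op A p X)) (nhds (p, X))"
    by simp
  then have "\<forall>\<^sub>F z in nhds (p, X). ereal (level_set_op A (fst z) (snd z)) < y"
    using y by (rule order_tendstoD)
  then show "\<forall>\<^sub>F z in inf (nhds (p, X)) (principal op_domain).
      (case z of (q, Y) \<Rightarrow> ereal (level_set_op A q Y)) < y"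
    by (simp add: eventually_inf_principal case_prod_beta eventually_mono)
qed

lemma level_set_op_uminus: "level_set_op A (- p) (- X) = - level_set_op (- A) p X"
proof -
  have "- X *v - p = X *v p"
    by (simp add: matrix_vector_mult_def vec_eq_iff)
  moreover have "trace (- X) = - trace X" by (simp add: trace_def sum_negf)
  ultimately show ?thesis by (simp add: level_set_op_eq)
qed

text \<open>The curvature term is odd under (p, X) -> (-p, -X) whereas the driving term is even, so
  the sign of \<open>A\<close> flips. This turns estimates for subsolutions with \<open>- A\<close>
  into estimates for supersolutions with \<open>A\<close>.\<close>

lemma lower_op_uminus: "- upper_op (- A) p X \<le> lower_op A (- p) (- X)"
  unfolding lower_op_def le_Liminf_iff
proof (intro allI impI)
  fix y :: ereal assume "y < - upper_op (- A) p X"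
  then have "upper_op (- A) p X < - y"
    by (simp add: ereal_less_uminus_reorder)
  then have "\<forall>\<^sub>F z in inf (nhds (p, X)) (principal op_domain).
      (case z of (q, Y) \<Rightarrow> ereal (level_set_op (- A) q Y)) < - y"
    unfolding upper_op_def by (rule Limsup_lessD)
  then have "\<forall>\<^sub>F z in nhds (p, X). z \<in> op_domain \<longrightarrow> ereal (level_set_op (- A) (fst z) (snd z)) < - y"
    by (simp add: eventually_inf_principal case_prod_beta)
  moreover have "filterlim uminus (nhds (p, X)) (nhds (- p, - X))"
    using tendsto_minus[OF filterlim_ident[of "nhds (- p, - X)"]] by simp
  ultimately have "\<forall>\<^sub>F z in nhds (- p, - X).
      - z \<in> op_domain \<longrightarrow> ereal (level_set_op (- A) (fst (- z)) (snd (- z))) < - y"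
    by (rule eventually_compose_filterlim)
  moreover have "- z \<in> op_domain" if "z \<in> op_domain" for z :: "(real^'a) \<times> (real^'a^'a)"
    using that by (cases z) (auto simp: op_domain_def transpose_def vec_eq_iff)
  moreover have "y < ereal (level_set_op A q Y)"
    if "ereal (level_set_op (- A) (- q) (- Y)) < - y" for q :: "real^'a" and Y
    using that level_set_op_uminus[of "- A" q Y] by (cases y) auto
  ultimately show "\<forall>\<^sub>F z in inf (nhds (- p, - X)) (principal op_domain).
      y < (case z of (q, Y) \<Rightarrow> ereal (level_set_op A q Y))"
    unfolding eventually_inf_principal
    by (auto elim!: eventually_mono simp: case_prod_beta)
qed

section \<open>Touching by functions of a smooth function\<close>

text \<open>Times are restricted to \<open>J\<close> because the penalty \<eta> / (\<tau> - t) blows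
  up at \<tau> and the moving curve exists only for a limited time.\<close>

definition test_function_on ::
  "real set \<Rightarrow> (real^'n \<Rightarrow> real \<Rightarrow> real) \<Rightarrow> (real^'n \<Rightarrow> real \<Rightarrow> real) \<Rightarrow> (real^'n \<Rightarrow> real \<Rightarrow> real^'n)
     \<Rightarrow> (real^'n \<Rightarrow> real \<Rightarrow> real^'n^'n) \<Rightarrow> bool" where
  "test_function_on J \<phi> \<phi>t g H \<longleftrightarrow>
     (\<forall>x. \<forall>t\<in>J.
        ((\<lambda>z. \<phi> (fst z) (snd z)) has_derivative (\<lambda>h. g x t \<bullet> fst h + \<phi>t x t * snd h)) (at (x, t)) \<and>
        ((\<lambda>y. g y t) has_derivative (\<lambda>h. H x t *v h)) (at x)) \<and>
     continuous_on (UNIV \<times> J) (\<lambda>z. \<phi>t (fst z) (snd z)) \<and>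
     continuous_on (UNIV \<times> J) (\<lambda>z. g (fst z) (snd z)) \<and>
     continuous_on (UNIV \<times> J) (\<lambda>z. H (fst z) (snd z))"

section \<open>Gluing at zero and prolonging test functions in time\<close>

lemma deriv_glue_zero:
  fixes f f' :: "real \<Rightarrow> real"
  assumes "\<And>y. (f has_real_derivative f' y) (at y)" "f 0 = 0" "f' 0 = 0"
  shows "((\<lambda>y. if y \<le> 0 then 0 else f y) has_real_derivative (if y \<le> 0 then 0 else f' y)) (at y)"
proof -
  have "((\<lambda>y. if y \<in> {..0} then 0 else f y) has_derivative
      (if y \<in> {..0} then (\<lambda>x. 0) else (\<lambda>x. f' y * x))) (at y within {..0} \<union> {0<..})"
    by (rule has_derivative_If_within_closures[where f' = "\<lambda>y x. 0" and g' = "\<lambda>y x. f' y * x"])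
      (use assms in \<open>auto simp: has_field_derivative_def intro: has_derivative_at_withinI\<close>)
  moreover have "{..0} \<union> {0<..} = (UNIV :: real set)" by auto
  ultimately show ?thesis
    by (cases "y \<le> 0") (simp_all add: has_field_derivative_def lambda_zero)
qed

lemma continuous_glue_zero:
  fixes f :: "real \<Rightarrow> real"
  assumes "continuous_on UNIV f" "f 0 = 0"
  shows "continuous_on UNIV (\<lambda>y. if y \<le> 0 then 0 else f y)"
proof -
  have "continuous_on ({..0} \<union> {0..}) (\<lambda>y. if y \<le> 0 then 0 else f y)"
    by (intro continuous_on_If) (use assms in \<open>auto intro: continuous_on_subset\<close>)
  moreover have "{..0} \<union> {0..} = (UNIV :: real set)" by auto
  ultimately show ?thesis by simp
qed

text \<open>Reparametrising time by \<open>c\<close> turns a test function on (0, \<tau>) into one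
  for all positive times, unchanged up to time \<open>r\<close>.\<close>

lemma smooth_time_cutoff:
  fixes r \<tau> :: real
  assumes "0 < r" "r < \<tau>"
  obtains c c' where
    "\<And>s. (c has_real_derivative c' s) (at s)" "continuous_on UNIV c'"
    "\<And>s. s \<le> r \<Longrightarrow> c s = s" "\<And>s. s \<le> r \<Longrightarrow> c' s = 1" "\<And>s. 0 < s \<Longrightarrow> c s \<in> {0<..<\<tau>}"
proof -
  define e where "e = \<tau> - r"
  have e: "0 < e" using assms by (simp add: e_def)
  \<comment> \<open>Beyond \<open>r\<close> this gives c = r + e (1 - exp (- y)) with y = (s - r) /
    e, which saturates below r + e = \<tau>. Value and slope of \<open>k\<close> vanish at 0, so the
    gluing is C^1.\<close>
  define k k' where "k = (\<lambda>y::real. if y \<le> 0 then 0 else 1 - exp (- y) - y)"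
    and "k' = (\<lambda>y::real. if y \<le> 0 then 0 else exp (- y) - 1)"
  have k: "(k has_real_derivative k' y) (at y)" for y
    unfolding k_def k'_def
    by (rule deriv_glue_zero) (auto intro!: derivative_eq_intros)
  have k': "continuous_on UNIV k'"
    unfolding k'_def by (intro continuous_glue_zero continuous_intros) auto
  define c where "c = (\<lambda>s. s + e * k ((s - r) / e))"
  define c' where "c' = (\<lambda>s. 1 + k' ((s - r) / e))"
  show thesis
  proof
    show "(c has_real_derivative c' s) (at s)" for s
      unfolding c_def c'_def using e
      by (auto intro!: derivative_eq_intros DERIV_chain2[OF k])
    show "continuous_on UNIV c'"
      unfolding c'_def using e by (intro continuous_intros continuous_on_compose2[OF k']) auto
    show "c s = s" "c' s = 1" if "s \<le> r" for s
      using that e by (auto simp: c_def c'_def k_def k'_def divide_le_0_iff)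
    show "c s \<in> {0<..<\<tau>}" if "0 < s" for s
    proof (cases "s \<le> r")
      case False
      define y where "y = (s - r) / e"
      have y: "0 < y" "s = r + e * y" using False e by (auto simp: y_def)
      have "c s = r + e * (1 - exp (- y))"
        using y e unfolding c_def y_def[symmetric] k_def by (simp add: algebra_simps)
      moreover have "0 < e * (1 - exp (- y))" "e * (1 - exp (- y)) < e"
        using y e by (simp_all add: mult_less_cancel_left1)
      ultimately show ?thesis using assms unfolding greaterThanLessThan_iff e_def by linarith
    qed (use that assms e in \<open>auto simp: c_def k_def divide_le_0_iff\<close>)
  qed
qed

lemma viscosity_subsolution_on_interval:
  assumes sub: "viscosity_subsolution A \<psi>" and tf: "test_function_on {0<..<\<tau>} \<phi> \<phi>t g H"
    and t0: "t0 \<in> {0<..<\<tau>}"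
    and max: "\<forall>\<^sub>F z in nhds (x0, t0). \<psi> (fst z) (snd z) - \<phi> (fst z) (snd z) \<le> \<psi> x0 t0 - \<phi> x0 t0"
  shows "ereal (\<phi>t x0 t0) \<le> upper_op A (g x0 t0) (H x0 t0)"
proof -
  \<comment> \<open>The midpoint lies beyond \<open>t0\<close>, so the cutoff is the identity in a
    whole neighbourhood of \<open>t0\<close> and the touching is unaffected.\<close>
  define r where "r = (t0 + \<tau>) / 2"
  have r: "0 < r" "r < \<tau>" "t0 < r" using t0 by (auto simp: r_def)
  obtain c c' where c: "\<And>s. (c has_real_derivative c' s) (at s)" "continuous_on UNIV c'"
    "\<And>s. s \<le> r \<Longrightarrow> c s = s" "\<And>s. s \<le> r \<Longrightarrow> c' s = 1" "\<And>s. 0 < s \<Longrightarrow> c s \<in> {0<..<\<tau>}"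
    using smooth_time_cutoff[OF r(1,2)] by metis
  have contc: "continuous_on UNIV c"
    using c(1) by (meson DERIV_isCont continuous_at_imp_continuous_on)
  have comp: "continuous_on (UNIV \<times> {0<..}) (\<lambda>z. f (fst z) (c (snd z)))"
    if "continuous_on (UNIV \<times> {0<..<\<tau>}) (\<lambda>z. f (fst z) (snd z))"
    for f :: "real^'a \<Rightarrow> real \<Rightarrow> 'b :: topological_space"
  proof -
    have "continuous_on (UNIV \<times> {0<..}) (\<lambda>z. (fst z, c (snd z)))"
      by (intro continuous_intros continuous_on_compose2[OF contc]) auto
    from continuous_on_compose2[OF that this] show ?thesis using c(5) by (force simp: image_subset_iff)
  qed
  have "test_function (\<lambda>x t. \<phi> x (c t)) (\<lambda>x t. \<phi>t x (c t) * c' t) (\<lambda>x t. g x (c t)) (\<lambda>x t. H x (c t))"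
    unfolding test_function_def
  proof (intro conjI allI impI)
    fix x :: "real^'a" and t :: real assume "0 < t"
    then have ct: "c t \<in> {0<..<\<tau>}" using c(5) by blast
    have "((\<lambda>z. \<phi> (fst z) (snd z)) has_derivative
        (\<lambda>h. g x (c t) \<bullet> fst h + \<phi>t x (c t) * snd h)) (at (x, c t))"
      using tf ct by (auto simp: test_function_on_def)
    moreover have "((\<lambda>z. (fst z, c (snd z))) has_derivative (\<lambda>h. (fst h, c' t * snd h))) (at (x, t))"
      using c(1)[of t]
      by (auto intro!: derivative_eq_intros has_derivative_compose[of snd _ _ _ c]
          simp: has_field_derivative_def)
    ultimately show "((\<lambda>z. \<phi> (fst z) (c (snd z))) has_derivative
        (\<lambda>h. g x (c t) \<bullet> fst h + \<phi>t x (c t) * c' t * snd h)) (at (x, t))"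
      using has_derivative_compose[of "\<lambda>z. (fst z, c (snd z))" "\<lambda>h. (fst h, c' t * snd h)" "(x, t)" UNIV
          "\<lambda>z. \<phi> (fst z) (snd z)" "\<lambda>h. g x (c t) \<bullet> fst h + \<phi>t x (c t) * snd h"]
      by (simp add: mult.assoc)
    show "((\<lambda>y. g y (c t)) has_derivative (\<lambda>h. H x (c t) *v h)) (at x)"
      using tf ct by (auto simp: test_function_on_def)
  next
    show "continuous_on (UNIV \<times> {0<..}) (\<lambda>z. \<phi>t (fst z) (c (snd z)) * c' (snd z))"
      using tf by (intro continuous_intros comp[of \<phi>t] continuous_on_compose2[OF c(2)])
        (auto simp: test_function_on_def)
  qed (use tf in \<open>auto intro!: comp simp: test_function_on_def\<close>)
  moreover have "\<forall>\<^sub>F z in nhds (x0, t0). snd z < r"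
    using r(3) eventually_nhds_in_open[of "UNIV \<times> {..<r}" "(x0, t0)"]
    by (auto simp: open_Times elim: eventually_mono)
  then have "\<forall>\<^sub>F z in nhds (x0, t0).
      \<psi> (fst z) (snd z) - \<phi> (fst z) (c (snd z)) \<le> \<psi> x0 t0 - \<phi> x0 (c t0)"
    using max by eventually_elim (use c(3)[of t0] c(3) r in simp)
  ultimately have "ereal (\<phi>t x0 (c t0) * c' t0) \<le> upper_op A (g x0 (c t0)) (H x0 (c t0))"
    using sub t0 unfolding viscosity_subsolution_def by fastforce
  then show ?thesis using c(3,4)[of t0] r by simp
qed

lemma viscosity_supersolution_uminus:
  assumes "viscosity_supersolution A \<psi>"
  shows "viscosity_subsolution (- A) (\<lambda>x t. - \<psi> x t)"
  unfolding viscosity_subsolution_def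
proof (intro allI impI)
  fix \<phi> \<phi>t g H and x :: "real^'a" and t :: real
  assume tf: "test_function \<phi> \<phi>t g H" and t: "0 < t"
    and max: "\<forall>\<^sub>F z in nhds (x, t). - \<psi> (fst z) (snd z) - \<phi> (fst z) (snd z) \<le> - \<psi> x t - \<phi> x t"
  have mv: "- M *v h = - (M *v h)" for M :: "real^'a^'a" and h
    by (simp add: matrix_vector_mult_def vec_eq_iff sum_negf)
  have "test_function (\<lambda>x t. - \<phi> x t) (\<lambda>x t. - \<phi>t x t) (\<lambda>x t. - g x t) (\<lambda>x t. - H x t)"
    unfolding test_function_def
  proof (intro conjI allI impI)
    fix x :: "real^'a" and t :: real assume "0 < t"
    then have d: "((\<lambda>z. \<phi> (fst z) (snd z)) has_derivative (\<lambda>h. g x t \<bullet> fst h + \<phi>t x t * snd h)) (at (x, t))"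
        "((\<lambda>y. g y t) has_derivative (\<lambda>h. H x t *v h)) (at x)"
      using tf by (auto simp: test_function_def)
    show "((\<lambda>z. - \<phi> (fst z) (snd z)) has_derivative (\<lambda>h. - g x t \<bullet> fst h + - \<phi>t x t * snd h)) (at (x, t))"
      using has_derivative_minus[OF d(1)] by simp
    show "((\<lambda>y. - g y t) has_derivative (\<lambda>h. - H x t *v h)) (at x)"
      using has_derivative_minus[OF d(2)] by (simp add: mv)
  qed (use tf in \<open>auto intro!: continuous_intros simp: test_function_def\<close>)
  moreover have "\<forall>\<^sub>F z in nhds (x, t). \<psi> (fst z) (snd z) - - \<phi> (fst z) (snd z) \<ge> \<psi> x t - - \<phi> x t"
    using max by (rule eventually_mono) simp
  ultimately have "ereal (- \<phi>t x t) \<ge> lower_op A (- g x t) (- H x t)"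
    using assms t unfolding viscosity_supersolution_def by fast
  with lower_op_uminus[of A "g x t" "H x t"] have "- upper_op (- A) (g x t) (H x t) \<le> - ereal (\<phi>t x t)"
    by simp
  then show "ereal (\<phi>t x t) \<le> upper_op (- A) (g x t) (H x t)"
    by (simp only: ereal_minus_le_minus)
qed

lemma test_function_on_compose:
  assumes tf: "test_function_on J U Ut g H"
    and F: "\<And>u. (F has_real_derivative F' u) (at u)" "\<And>u. (F' has_real_derivative F'' u) (at u)"
      "continuous_on UNIV F''"
    and f: "\<And>t. t \<in> J \<Longrightarrow> (f has_real_derivative f' t) (at t)" "continuous_on J f'"
  shows "test_function_on J (\<lambda>x t. F (U x t) + f t) (\<lambda>x t. F' (U x t) * Ut x t + f' t)
    (\<lambda>x t. F' (U x t) *\<^sub>R g x t)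
    (\<lambda>x t. F' (U x t) *\<^sub>R H x t + F'' (U x t) *\<^sub>R outer_prod (g x t) (g x t))"
proof -
  have dU: "((\<lambda>z. U (fst z) (snd z)) has_derivative (\<lambda>h. g x t \<bullet> fst h + Ut x t * snd h)) (at (x, t))"
    and dg: "((\<lambda>y. g y t) has_derivative (\<lambda>h. H x t *v h)) (at x)" if "t \<in> J" for x t
    using tf that by (auto simp: test_function_on_def)
  have "continuous (at z) (\<lambda>z. U (fst z) (snd z))" if "z \<in> UNIV \<times> J" for z
    using dU[of "snd z" "fst z"] that has_derivative_continuous by fastforce
  then have cU: "continuous_on (UNIV \<times> J) (\<lambda>z. U (fst z) (snd z))"
    by (intro continuous_at_imp_continuous_on) blast
  have cF': "continuous_on UNIV F'"
    using F(2) by (meson DERIV_isCont continuous_at_imp_continuous_on)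
  show ?thesis
    unfolding test_function_on_def
  proof (intro conjI allI ballI)
    fix x t assume t: "t \<in> J"
    show "((\<lambda>z. F (U (fst z) (snd z)) + f (snd z)) has_derivative
        (\<lambda>h. F' (U x t) *\<^sub>R g x t \<bullet> fst h + (F' (U x t) * Ut x t + f' t) * snd h)) (at (x, t))"
      using F(1)[of "U x t"] f(1)[OF t] unfolding has_field_derivative_def
      by (auto intro!: derivative_eq_intros has_derivative_compose[OF dU[OF t], of F]
          has_derivative_compose[of snd _ _ _ f] simp: algebra_simps)
    have "((\<lambda>y. (y, t)) has_derivative (\<lambda>h. (h, 0))) (at x)"
      by (auto intro!: derivative_eq_intros)
    from has_derivative_compose[OF this dU[OF t, of x]]
    have dUx: "((\<lambda>y. U y t) has_derivative (\<lambda>h. g x t \<bullet> h)) (at x)" by simp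
    show "((\<lambda>y. F' (U y t) *\<^sub>R g y t) has_derivative
        (\<lambda>h. (F' (U x t) *\<^sub>R H x t + F'' (U x t) *\<^sub>R outer_prod (g x t) (g x t)) *v h)) (at x)"
      using F(2)[of "U x t"] unfolding has_field_derivative_def
      by (auto intro!: derivative_eq_intros has_derivative_compose[OF dUx, of F'] dg[OF t]
          simp: matrix_vector_mult_add_rdistrib matrix_vec_scaleR outer_prod_mult_vec algebra_simps)
  next
    show "continuous_on (UNIV \<times> J) (\<lambda>z. F' (U (fst z) (snd z)) * Ut (fst z) (snd z) + f' (snd z))"
      using tf by (intro continuous_intros continuous_on_compose2[OF cF' cU] continuous_on_compose2[OF f(2)])
        (auto simp: test_function_on_def)
    show "continuous_on (UNIV \<times> J) (\<lambda>z. F' (U (fst z) (snd z)) *\<^sub>R g (fst z) (snd z))"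
      using tf by (intro continuous_intros continuous_on_compose2[OF cF' cU])
        (auto simp: test_function_on_def)
    show "continuous_on (UNIV \<times> J) (\<lambda>z. F' (U (fst z) (snd z)) *\<^sub>R H (fst z) (snd z) +
        F'' (U (fst z) (snd z)) *\<^sub>R outer_prod (g (fst z) (snd z)) (g (fst z) (snd z)))"
      using tf unfolding outer_prod_def
      by (intro continuous_intros continuous_on_compose2[OF cF' cU] continuous_on_compose2[OF F(3) cU])
        (auto simp: test_function_on_def intro!: continuous_on_vec_lambda continuous_intros)
  qed
qed

text \<open>The penalty contributes the strictly positive time derivative \<eta> / (\<tau> - t)^2,
  so a nonstrict inequality for \<open>U\<close> suffices for a contradiction. In the first
  alternative gradient and Hessian of the test function both vanish and \<open>upper_op_zero\<close>
  applies; in the second, \<open>level_set_op_geometric\<close> removes \<open>F\<close>.\<close>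

lemma no_touching:
  assumes sub: "viscosity_subsolution A \<psi>" and tf: "test_function_on {0<..<\<tau>} U Ut g H"
    and F: "\<And>u. (F has_real_derivative F' u) (at u)" "\<And>u. (F' has_real_derivative F'' u) (at u)"
      "continuous_on UNIV F''"
    and t0: "t0 \<in> {0<..<\<tau>}" and \<eta>: "0 < \<eta>"
    and cases: "F' (U x0 t0) = 0 \<and> (F'' (U x0 t0) = 0 \<or> g x0 t0 = 0) \<or>
      F' (U x0 t0) > 0 \<and> g x0 t0 \<noteq> 0 \<and> level_set_op A (g x0 t0) (H x0 t0) \<le> Ut x0 t0"
    and max: "\<forall>\<^sub>F z in nhds (x0, t0).
      \<psi> (fst z) (snd z) - F (U (fst z) (snd z)) - \<eta> / (\<tau> - snd z) \<le> \<psi> x0 t0 - F (U x0 t0) - \<eta> / (\<tau> - t0)"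
  shows False
proof -
  let ?g = "F' (U x0 t0) *\<^sub>R g x0 t0"
  let ?H = "F' (U x0 t0) *\<^sub>R H x0 t0 + F'' (U x0 t0) *\<^sub>R outer_prod (g x0 t0) (g x0 t0)"
  let ?f' = "\<lambda>t. \<eta> / (\<tau> - t)\<^sup>2"
  have "test_function_on {0<..<\<tau>} (\<lambda>x t. F (U x t) + \<eta> / (\<tau> - t)) (\<lambda>x t. F' (U x t) * Ut x t + ?f' t)
    (\<lambda>x t. F' (U x t) *\<^sub>R g x t)
    (\<lambda>x t. F' (U x t) *\<^sub>R H x t + F'' (U x t) *\<^sub>R outer_prod (g x t) (g x t))"
    by (rule test_function_on_compose[OF tf F])
      (auto intro!: derivative_eq_intros continuous_intros simp: power2_eq_square)
  moreover have "\<forall>\<^sub>F z in nhds (x0, t0). \<psi> (fst z) (snd z) - (F (U (fst z) (snd z)) + \<eta> / (\<tau> - snd z))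
      \<le> \<psi> x0 t0 - (F (U x0 t0) + \<eta> / (\<tau> - t0))"
    using max by (simp add: diff_diff_eq)
  ultimately have le: "ereal (F' (U x0 t0) * Ut x0 t0 + ?f' t0) \<le> upper_op A ?g ?H"
    using viscosity_subsolution_on_interval[OF sub _ t0] by fast
  have pos: "0 < ?f' t0" using \<eta> t0 by simp
  from cases show False
  proof
    assume "F' (U x0 t0) = 0 \<and> (F'' (U x0 t0) = 0 \<or> g x0 t0 = 0)"
    then have "ereal (?f' t0) \<le> upper_op A 0 (0 :: real^'a^'a)" using le by auto
    also note upper_op_zero
    finally show False using pos by simp
  next
    assume c: "F' (U x0 t0) > 0 \<and> g x0 t0 \<noteq> 0 \<and> level_set_op A (g x0 t0) (H x0 t0) \<le> Ut x0 t0"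
    note le
    also have "upper_op A ?g ?H \<le> ereal (level_set_op A ?g ?H)"
      by (rule upper_op_le) (use c in auto)
    also have "level_set_op A ?g ?H = F' (U x0 t0) * level_set_op A (g x0 t0) (H x0 t0)"
      using c by (intro level_set_op_geometric) auto
    also have "ereal \<dots> \<le> ereal (F' (U x0 t0) * Ut x0 t0)"
      using c by simp
    finally show False using pos by simp
  qed
qed

section \<open>Barriers\<close>

text \<open>The cube is the lowest integer power whose extension by zero is C^2. Where u <= 0 its
  first two derivatives vanish and touching is degenerate in the sense of
  \<open>no_touching\<close>, so a barrier has to be a supersolution only where it is
  positive.\<close>

definition pos_cube :: "real \<Rightarrow> real \<Rightarrow> real" where
  "pos_cube C u = (if u \<le> 0 then 0 else C * u ^ 3)"

lemma pos_cube_nonneg: "0 \<le> C \<Longrightarrow> 0 \<le> pos_cube C u"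
  by (simp add: pos_cube_def)

lemma pos_cube_ge:
  assumes "0 \<le> M" "0 < d" "d \<le> u" "M / d ^ 3 \<le> C"
  shows "M \<le> pos_cube C u"
proof -
  have "M = M / d ^ 3 * d ^ 3" using assms by simp
  also have "\<dots> \<le> C * u ^ 3"
    using assms by (intro mult_mono power_mono) (auto intro: order_trans[of _ "M / d ^ 3"])
  finally show ?thesis using assms by (simp add: pos_cube_def)
qed

lemma pos_cube_deriv:
  "(pos_cube C has_real_derivative (if u \<le> 0 then 0 else 3 * C * u\<^sup>2)) (at u)"
  "((\<lambda>u. if u \<le> 0 then 0 else 3 * C * u\<^sup>2) has_real_derivative (if u \<le> 0 then 0 else 6 * C * u)) (at u)"
  "continuous_on UNIV (\<lambda>u. if u \<le> 0 then 0 else 6 * C * u)"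
  unfolding pos_cube_def
  by (rule deriv_glue_zero continuous_glue_zero; (auto intro!: derivative_eq_intros continuous_intros)[1])+

text \<open>A positive excess over the barrier survives a small penalty in time. By
  \<open>frontier\<close> and \<open>initial\<close> the penalised difference then has its maximum
  in the interior of \<open>Q\<close> at a positive time, where \<open>no_touching\<close> excludes
  it whatever the sign of \<open>U\<close>.\<close>

lemma barrier:
  assumes sub: "viscosity_subsolution A \<psi>"
    and cont: "continuous_on (UNIV \<times> {0..}) (\<lambda>z. \<psi> (fst z) (snd z))"
    and bound: "\<And>x t. t \<in> {0..\<tau>} \<Longrightarrow> \<psi> x t \<le> M"
    and Q: "compact Q"
    and tf: "test_function_on {0<..<\<tau>} U Ut g H"
    and contU: "continuous_on (Q \<times> {0..<\<tau>}) (\<lambda>z. U (fst z) (snd z))"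
    and C: "0 < C" and \<epsilon>: "0 \<le> \<epsilon>"
    and super: "\<And>x t. x \<in> interior Q \<Longrightarrow> t \<in> {0<..<\<tau>} \<Longrightarrow> 0 < U x t \<Longrightarrow>
      g x t \<noteq> 0 \<and> level_set_op A (g x t) (H x t) \<le> Ut x t"
    and frontier: "\<And>x t. x \<in> Q \<Longrightarrow> x \<notin> interior Q \<Longrightarrow> t \<in> {0..<\<tau>} \<Longrightarrow> \<psi> x t \<le> pos_cube C (U x t) + \<epsilon>"
    and initial: "\<And>x. x \<in> Q \<Longrightarrow> \<psi> x 0 \<le> pos_cube C (U x 0) + \<epsilon>"
    and x: "x \<in> Q" and t: "t \<in> {0..<\<tau>}"
  shows "\<psi> x t \<le> pos_cube C (U x t) + \<epsilon>"
proof (rule ccontr)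
  define d where "d = \<psi> x t - pos_cube C (U x t) - \<epsilon>"
  assume "\<not> \<psi> x t \<le> pos_cube C (U x t) + \<epsilon>"
  then have d: "0 < d" by (simp add: d_def)
  \<comment> \<open>With this value the penalty at time \<open>t\<close> is d / 2, so half of the
    excess remains.\<close>
  define \<eta> where "\<eta> = d * (\<tau> - t) / 2"
  have \<eta>: "0 < \<eta>" using d t by (simp add: \<eta>_def)
  define N where "N = max 1 (M - \<epsilon>)"
  have N: "1 \<le> N" "M - \<epsilon> \<le> N" by (auto simp: N_def)
  \<comment> \<open>During the last time span of length \<beta> the penalty is at least N >= M -
    \<epsilon>, so the maximum can be sought over the compact interval up to \<tau> -
    \<beta>.\<close>
  define \<beta> where "\<beta> = \<eta> / N"
  have \<beta>: "0 < \<beta>" using \<eta> N by (simp add: \<beta>_def)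
  define \<Phi> where "\<Phi> z = \<psi> (fst z) (snd z) - pos_cube C (U (fst z) (snd z)) - \<epsilon> - \<eta> / (\<tau> - snd z)" for z
  have late: "\<Phi> (y, s) \<le> 0" if "\<tau> - \<beta> \<le> s" "s < \<tau>" "0 \<le> s" for y s
  proof -
    have "N \<le> \<eta> / (\<tau> - s)"
      using that N \<eta> by (simp add: \<beta>_def field_simps)
    moreover have "\<psi> y s \<le> M" using that bound by simp
    ultimately show ?thesis using N pos_cube_nonneg[of C "U y s"] C by (simp add: \<Phi>_def)
  qed
  have start: "0 < \<Phi> (x, t)"
  proof -
    have "\<eta> / (\<tau> - t) = d / 2" using t by (simp add: \<eta>_def field_simps)
    then show ?thesis using d by (simp add: \<Phi>_def d_def)
  qed
  let ?S = "Q \<times> {0..\<tau> - \<beta>}"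
  have "(x, t) \<in> ?S" using late[of t x] start x t by fastforce
  moreover have "compact ?S" using Q by (intro compact_Times) auto
  moreover have "continuous_on ?S \<Phi>"
  proof -
    have "continuous_on UNIV (pos_cube C)"
      using pos_cube_deriv(1) by (meson DERIV_isCont continuous_at_imp_continuous_on)
    moreover have "continuous_on ?S (\<lambda>z. U (fst z) (snd z))"
      by (rule continuous_on_subset[OF contU]) (use \<beta> in auto)
    moreover have "continuous_on ?S (\<lambda>z. \<psi> (fst z) (snd z))"
      by (rule continuous_on_subset[OF cont]) auto
    ultimately show ?thesis
      unfolding \<Phi>_def using \<beta> by (intro continuous_intros) (auto intro: continuous_on_compose2)
  qed
  ultimately obtain z0 where z0: "z0 \<in> ?S" "\<And>z. z \<in> ?S \<Longrightarrow> \<Phi> z \<le> \<Phi> z0"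
    by (metis (no_types, lifting) continuous_attains_sup empty_iff)
  obtain x0 t0 where [simp]: "z0 = (x0, t0)" by (cases z0)
  have pos: "0 < \<Phi> (x0, t0)" using z0(2)[OF \<open>(x, t) \<in> ?S\<close>] start by simp
  have x0: "x0 \<in> Q" and t0: "0 \<le> t0" "t0 < \<tau> - \<beta>"
    using z0(1) late[of t0 x0] pos \<beta> by (auto simp: not_less less_le)
  have pen: "0 < \<eta> / (\<tau> - t0)" using t0 \<beta> \<eta> by simp
  have "0 < t0"
    using initial[OF x0] pos pen t0 by (cases "t0 = 0") (auto simp: \<Phi>_def)
  moreover have int: "x0 \<in> interior Q"
    using frontier[OF x0, of t0] pos pen t0 \<beta> by (auto simp: \<Phi>_def)
  ultimately have "\<forall>\<^sub>F z in nhds (x0, t0). z \<in> interior Q \<times> {0<..<\<tau> - \<beta>}"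
    using t0 by (intro eventually_nhds_in_open open_Times) auto
  moreover have "z \<in> ?S" if "z \<in> interior Q \<times> {0<..<\<tau> - \<beta>}" for z
    using that interior_subset[of Q] by auto
  ultimately have "\<forall>\<^sub>F z in nhds (x0, t0). \<Phi> z \<le> \<Phi> (x0, t0)"
    using z0(2) by (auto elim: eventually_mono)
  then have "\<forall>\<^sub>F z in nhds (x0, t0). \<psi> (fst z) (snd z) - pos_cube C (U (fst z) (snd z)) - \<eta> / (\<tau> - snd z)
      \<le> \<psi> x0 t0 - pos_cube C (U x0 t0) - \<eta> / (\<tau> - t0)"
    by (rule eventually_mono) (simp add: \<Phi>_def)
  then show False
    using super[OF int, of t0] \<open>0 < t0\<close> t0 \<beta> \<eta> C
    by (intro no_touching[OF sub tf pos_cube_deriv, of t0 \<eta> x0 C]) auto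
qed

section \<open>Quadratic barriers: a shrinking disc and an opening hyperbola\<close>

lemma test_function_on_quadratic:
  fixes B :: "real^'n^'n"
  assumes B: "transpose B = B"
    and f: "\<And>t. t \<in> J \<Longrightarrow> (f has_real_derivative f' t) (at t)" "continuous_on J f'"
  shows "test_function_on J (\<lambda>x t. (x - z) \<bullet> (B *v (x - z)) + f t) (\<lambda>x t. f' t)
    (\<lambda>x t. 2 *\<^sub>R (B *v (x - z))) (\<lambda>x t. 2 *\<^sub>R B)"
  unfolding test_function_on_def
proof (intro conjI allI ballI)
  fix x t assume t: "t \<in> J"
  have sym: "a \<bullet> (B *v b) = b \<bullet> (B *v a)" for a b
    by (metis B dot_lmul_matrix inner_commute transpose_matrix_vector)
  have dB: "((\<lambda>y. B *v y) has_derivative (\<lambda>y. B *v y)) F" for F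
    by (rule bounded_linear_imp_has_derivative) (rule matrix_vector_mul_bounded_linear)
  show "((\<lambda>w. (fst w - z) \<bullet> (B *v (fst w - z)) + f (snd w)) has_derivative
      (\<lambda>h. 2 *\<^sub>R (B *v (x - z)) \<bullet> fst h + f' t * snd h)) (at (x, t))"
    using f(1)[OF t] unfolding has_field_derivative_def
    by (auto intro!: derivative_eq_intros has_derivative_compose[OF _ dB] has_derivative_compose[of snd _ _ _ f]
        simp: sym[of "x - z"] inner_commute)
  show "((\<lambda>y. 2 *\<^sub>R (B *v (y - z))) has_derivative (\<lambda>h. 2 *\<^sub>R B *v h)) (at x)"
    by (auto intro!: derivative_eq_intros has_derivative_compose[OF _ dB] simp: matrix_vec_scaleR)
next
  show "continuous_on (UNIV \<times> J) (\<lambda>w. f' (snd w))"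
    by (intro continuous_on_compose2[OF f(2)] continuous_intros) auto
qed (auto intro!: continuous_intros continuous_on_compose2[OF linear_continuous_on[OF matrix_vector_mul_bounded_linear]])

lemma inner_real2: "v \<bullet> w = v $ 1 * w $ 1 + v $ 2 * w $ 2" for v w :: "real^2"
  by (simp add: inner_vec_def sum_2)

text \<open>Finite speed of propagation: U <= 0 is a disc about \<open>z\<close> whose squared
  radius decreases at rate \<open>L\<close>, an upper bound for the operator on the ball of radius
  \<open>r\<close>. The condition on \<tau> keeps \<open>z\<close> in the disc.\<close>

lemma subsolution_nonpos_in_ball:
  fixes \<psi> :: "real^2 \<Rightarrow> real \<Rightarrow> real"
  assumes sub: "viscosity_subsolution A \<psi>"
    and cont: "continuous_on (UNIV \<times> {0..}) (\<lambda>z. \<psi> (fst z) (snd z))"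
    and bound: "\<And>x t. t \<in> {0..\<tau>} \<Longrightarrow> \<psi> x t \<le> M"
    and r: "0 < r" and init: "\<And>x. x \<in> cball z r \<Longrightarrow> \<psi> x 0 \<le> 0"
    and \<tau>: "(2 + 2 * \<bar>A\<bar> * r) * \<tau> \<le> (r / 2)\<^sup>2" and t: "t \<in> {0..<\<tau>}"
  shows "\<psi> z t \<le> 0"
proof -
  define L where "L = 2 + 2 * \<bar>A\<bar> * r"
  have L: "0 < L" using r by (simp add: L_def add_pos_nonneg)
  define f where "f = (\<lambda>t. L * t - (r / 2)\<^sup>2)"
  define B where "B = (mat 1 :: real^2^2)"
  define U where "U = (\<lambda>x t. (x - z) \<bullet> (B *v (x - z)) + f t)"
  have U: "U x t = (norm (x - z))\<^sup>2 + L * t - (r / 2)\<^sup>2" for x t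
    by (simp add: U_def B_def f_def power2_norm_eq_inner)
  define K where "K = \<bar>M\<bar> + 1"
  \<comment> \<open>On the boundary circle U >= 3/4 r^2, so this constant lifts the barrier above
    the bound \<open>M\<close> there.\<close>
  define C where "C = K / (r\<^sup>2 / 2) ^ 3"
  have C: "0 < C" using r by (simp add: C_def K_def)
  have "\<psi> z t \<le> pos_cube C (U z t) + 0"
  proof (rule barrier[OF sub cont bound, of \<tau> "cball z r" U "\<lambda>x t. L"
        "\<lambda>x t. 2 *\<^sub>R (B *v (x - z))" "\<lambda>x t. 2 *\<^sub>R B"])
    show "test_function_on {0<..<\<tau>} U (\<lambda>x t. L) (\<lambda>x t. 2 *\<^sub>R (B *v (x - z))) (\<lambda>x t. 2 *\<^sub>R B)"
      unfolding U_def
      by (rule test_function_on_quadratic)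
        (auto simp: B_def f_def transpose_mat intro!: derivative_eq_intros)
    show "continuous_on (cball z r \<times> {0..<\<tau>}) (\<lambda>w. U (fst w) (snd w))"
      unfolding U by (intro continuous_intros)
  next
    fix x s assume x: "x \<in> interior (cball z r)" and s: "s \<in> {0<..<\<tau>}" and pos: "0 < U x s"
    have xr: "norm (x - z) < r" using x by (simp add: dist_norm norm_minus_commute)
    have "L * s \<le> L * \<tau>" using s L by simp
    \<comment> \<open>At the centre U <= 0 up to time \<tau>, so positivity of \<open>U\<close>
      keeps away from the only zero of the gradient.\<close>
    then have "x \<noteq> z" using pos \<tau> by (auto simp: U L_def)
    then have nz: "(x - z) \<bullet> (x - z) \<noteq> 0" by simp
    have "trace (2 *\<^sub>R B) = 4" by (simp add: B_def trace_def mat_def sum_2)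
    moreover have "2 *\<^sub>R (B *v (x - z)) = 2 *\<^sub>R (x - z)" "2 *\<^sub>R B *v 2 *\<^sub>R (x - z) = 4 *\<^sub>R (x - z)"
      by (simp_all add: B_def matrix_vec_scaleR)
    moreover have "(norm (2 *\<^sub>R (x - z)))\<^sup>2 = 4 * ((x - z) \<bullet> (x - z))"
      by (simp add: power_mult_distrib power2_norm_eq_inner)
    ultimately have "level_set_op A (2 *\<^sub>R (B *v (x - z))) (2 *\<^sub>R B) = 2 + 2 * (A * norm (x - z))"
      using nz unfolding level_set_op_eq by simp
    moreover have "A * norm (x - z) \<le> \<bar>A\<bar> * r"
      using xr by (intro mult_mono) auto
    ultimately show "2 *\<^sub>R (B *v (x - z)) \<noteq> 0 \<and> level_set_op A (2 *\<^sub>R (B *v (x - z))) (2 *\<^sub>R B) \<le> L"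
      using \<open>x \<noteq> z\<close> by (simp add: L_def B_def)
  next
    fix x s assume x: "x \<in> cball z r" "x \<notin> interior (cball z r)" and s: "s \<in> {0..<\<tau>}"
    then have n: "norm (x - z) = r" by (simp add: dist_norm norm_minus_commute)
    have "0 \<le> L * s" "0 < r\<^sup>2" "(r / 2)\<^sup>2 = r\<^sup>2 / 4" using s L r by (simp_all add: power_divide)
    then have "r\<^sup>2 / 2 \<le> U x s" unfolding U n by linarith
    then have "K \<le> pos_cube C (U x s)"
      by (intro pos_cube_ge[of _ "r\<^sup>2 / 2"]) (use r in \<open>auto simp: K_def C_def\<close>)
    then show "\<psi> x s \<le> pos_cube C (U x s) + 0" using bound[of s x] s by (auto simp: K_def)
  next
    show "\<psi> x 0 \<le> pos_cube C (U x 0) + 0" if "x \<in> cball z r" for x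
      using init[OF that] pos_cube_nonneg[of C "U x 0"] C by linarith
  qed (use C t r in auto)
  moreover have "L * t \<le> L * \<tau>" using t L by simp
  then have "U z t \<le> 0" using \<tau> by (simp add: U L_def)
  ultimately show ?thesis by (simp add: pos_cube_def)
qed

text \<open>The exponent \<open>3/2\<close> works because in the barrier \<open>y\<^sup>2 - x\<^sup>2 - A t\<^sup>3\<^sup>/\<^sup>2\<close> the curvature term
  dominates within distance \<open>\<surd>t\<close> of the origin and the driving force \<open>A\<close> outside of it.\<close>

lemma subsolution_nonpos_in_cone:
  fixes \<psi> :: "real^2 \<Rightarrow> real \<Rightarrow> real"
  assumes sub: "viscosity_subsolution (- A) \<psi>" and A: "0 < A"
    and cont: "continuous_on (UNIV \<times> {0..}) (\<lambda>z. \<psi> (fst z) (snd z))"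
    and bound: "\<And>x t. t \<in> {0..\<tau>} \<Longrightarrow> \<psi> x t \<le> M"
    and h: "0 < h" and init: "\<And>x. \<bar>x $ 2\<bar> \<le> \<bar>x $ 1\<bar> \<Longrightarrow> \<bar>x $ 1\<bar> \<le> h \<Longrightarrow> \<psi> x 0 \<le> 0"
    and lateral: "\<And>x t. \<bar>x $ 1\<bar> = h \<Longrightarrow> \<bar>x $ 2\<bar> \<le> 3 / 2 * h \<Longrightarrow> t \<in> {0..<\<tau>} \<Longrightarrow> \<psi> x t \<le> 0"
    and \<tau>: "A * (\<tau> * sqrt \<tau>) \<le> h\<^sup>2 / 4" and t: "t \<in> {0..<\<tau>}"
    and x: "(x $ 2)\<^sup>2 \<le> (x $ 1)\<^sup>2 + A * (t * sqrt t)" "\<bar>x $ 1\<bar> \<le> h" "\<bar>x $ 2\<bar> \<le> 2 * h"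
  shows "\<psi> x t \<le> 0"
proof (rule field_le_epsilon)
  \<comment> \<open>No rate is known at which a positive \<psi> decays towards the cone, so no
    multiple of U^3 need dominate it initially. Allowing an error \<epsilon> leaves only points with
    \<psi> >= \<epsilon>, which keep a distance from the cone.\<close>
  fix \<epsilon> :: real assume \<epsilon>: "0 < \<epsilon>"
  define B :: "real^2^2" where "B = (\<chi> i j. if i = j then (if i = 1 then -1 else 1) else 0)"
  have Bv: "B *v w = vector [- w $ 1, w $ 2]" for w
    by (simp add: B_def matrix_vector_mult_def vec_eq_iff forall_2 sum_2)
  define f where "f = (\<lambda>t. - A * (t * sqrt t))"
  define f' where "f' = (\<lambda>t. - (3 / 2) * A * sqrt t)"
  define U where "U = (\<lambda>x t. (x - 0) \<bullet> (B *v (x - 0)) + f t)"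
  have U: "U x t = (x $ 2)\<^sup>2 - (x $ 1)\<^sup>2 - A * (t * sqrt t)" for x t
    by (simp add: U_def f_def Bv inner_real2 power2_eq_square)
  define Q :: "(real^2) set" where "Q = cbox (vector [- h, - 2 * h]) (vector [h, 2 * h])"
  have Q: "x \<in> Q \<longleftrightarrow> \<bar>x $ 1\<bar> \<le> h \<and> \<bar>x $ 2\<bar> \<le> 2 * h" for x
    by (auto simp: Q_def mem_box_cart forall_2)
  have intQ: "x \<in> interior Q \<longleftrightarrow> \<bar>x $ 1\<bar> < h \<and> \<bar>x $ 2\<bar> < 2 * h" for x
    by (auto simp: Q_def interior_cbox mem_box_cart forall_2)
  define K where "K = \<bar>M\<bar> + 1"
  have "continuous_on Q (\<lambda>x. \<psi> x 0)"
    by (rule continuous_on_compose2[OF cont, of _ "\<lambda>x. (x, 0)", simplified]) (auto intro!: continuous_intros)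
  then have "closed (Q \<inter> (\<lambda>x. \<psi> x 0) -` {\<epsilon>..})"
    by (intro continuous_closed_preimage) (auto simp: Q_def)
  then have "compact (Q \<inter> (Q \<inter> (\<lambda>x. \<psi> x 0) -` {\<epsilon>..}))"
    by (intro compact_Int_closed) (auto simp: Q_def)
  then have Z: "compact (Q \<inter> (\<lambda>x. \<psi> x 0) -` {\<epsilon>..})" (is "compact ?Z") by (simp add: Int_assoc[symmetric])
  \<comment> \<open>By \<open>init\<close> the set \<open>?Z\<close> avoids the cone, so
    \<open>U\<close> is positive on it at time 0 and, by compactness, bounded away from 0.\<close>
  obtain \<delta> where \<delta>: "0 < \<delta>" "\<And>x. x \<in> ?Z \<Longrightarrow> \<delta> \<le> U x 0"
  proof (cases "?Z = {}")
    case False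
    have "continuous_on ?Z (\<lambda>x. U x 0)" unfolding U by (intro continuous_intros)
    then obtain y where y: "y \<in> ?Z" "\<And>x. x \<in> ?Z \<Longrightarrow> U y 0 \<le> U x 0"
      using continuous_attains_inf[OF Z False] by blast
    have "\<not> \<bar>y $ 2\<bar> \<le> \<bar>y $ 1\<bar>" using init[of y] y(1) \<epsilon> by (auto simp: Q)
    then have "0 < U y 0" by (simp add: U abs_le_square_iff)
    then show ?thesis using that y by blast
  qed (use that[of 1] in auto)
  define C where "C = K / \<delta> ^ 3 + K / (h\<^sup>2) ^ 3"
  have K: "0 < K" by (simp add: K_def)
  have CK: "K / \<delta> ^ 3 \<le> C" "K / (h\<^sup>2) ^ 3 \<le> C" "0 < C"
    using K \<delta> h by (auto simp: C_def add_pos_pos)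
  have "\<psi> x t \<le> pos_cube C (U x t) + \<epsilon>"
  proof (rule barrier[OF sub cont bound, of \<tau> Q U "\<lambda>x. f'" "\<lambda>x t. 2 *\<^sub>R (B *v (x - 0))" "\<lambda>x t. 2 *\<^sub>R B"])
    show "test_function_on {0<..<\<tau>} U (\<lambda>x. f') (\<lambda>x t. 2 *\<^sub>R (B *v (x - 0))) (\<lambda>x t. 2 *\<^sub>R B)"
      unfolding U_def
    proof (rule test_function_on_quadratic)
      show "transpose B = B" by (auto simp: B_def transpose_def vec_eq_iff)
      show "(f has_real_derivative f' t) (at t)" if "t \<in> {0<..<\<tau>}" for t
      proof -
        have "0 < t" using that by simp
        have "(f has_real_derivative - A * (t * (inverse (sqrt t) / 2) + 1 * sqrt t)) (at t)"
          unfolding f_def using \<open>0 < t\<close> by (intro DERIV_cmult DERIV_mult' DERIV_ident DERIV_real_sqrt)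
        moreover have "t * inverse (sqrt t) = sqrt t"
          using real_div_sqrt[of t] \<open>0 < t\<close> by (simp only: divide_inverse)
        ultimately show ?thesis by (simp add: f'_def mult_ac)
      qed
      show "continuous_on {0<..<\<tau>} f'" unfolding f'_def by (intro continuous_intros)
    qed
    show "continuous_on (Q \<times> {0..<\<tau>}) (\<lambda>w. U (fst w) (snd w))"
      unfolding U by (intro continuous_intros)
  next
    fix y s assume y: "y \<in> interior Q" and s: "s \<in> {0<..<\<tau>}" and pos: "0 < U y s"
    define R where "R = norm (2 *\<^sub>R (B *v (y - 0))) / 2"
    have R2: "(norm (2 *\<^sub>R (B *v (y - 0))))\<^sup>2 = 4 * R\<^sup>2" by (simp add: R_def power_divide)
    define q where "q = sqrt s"
    have q: "0 < q" using s by (simp add: q_def)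
    have qs: "s = q\<^sup>2" using s by (simp add: q_def)
    define D where "D = (y $ 2)\<^sup>2 - (y $ 1)\<^sup>2"
    have gt: "A * q * q\<^sup>2 < D"
      using pos q by (simp add: U qs power2_eq_square D_def)
    have Aq: "0 < A * q" using A q by simp
    have "0 < A * q * q\<^sup>2" using Aq q by simp
    with gt have D: "0 < D" by linarith
    then have "y $ 2 \<noteq> 0" using zero_le_power2[of "y $ 1"] by (intro notI) (simp add: D_def)
    then have nz: "2 *\<^sub>R (B *v (y - 0)) \<noteq> 0" by (auto simp: Bv vec_eq_iff forall_2)
    then have R: "0 < R" by (simp add: R_def)
    have "level_set_op (- A) (2 *\<^sub>R (B *v (y - 0))) (2 *\<^sub>R B) = - (2 * (D / R\<^sup>2)) - 2 * (A * R)"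
    proof -
      have "trace (2 *\<^sub>R B) = 0" by (simp add: trace_def sum_2 B_def)
      moreover have "2 *\<^sub>R (B *v (y - 0)) \<bullet> (2 *\<^sub>R B *v 2 *\<^sub>R (B *v (y - 0))) = 8 * D"
        by (simp add: matrix_vec_scaleR Bv inner_real2 power2_eq_square algebra_simps D_def)
      moreover have "norm (2 *\<^sub>R (B *v (y - 0))) = 2 * R" by (simp add: R_def)
      moreover have "8 * D / (4 * R\<^sup>2) = 2 * (D / R\<^sup>2)" by simp
      ultimately show ?thesis unfolding level_set_op_eq R2 by (simp only:)
    qed
    also have "\<dots> \<le> f' s"
    proof -
      \<comment> \<open>Here \<open>R\<close> is the distance to the origin. If q <= R the driving
        term suffices; if q > R, positivity of \<open>U\<close> gives D > A q^3 >= A q R^2, so the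
        curvature term does. Either one contributes 2 A q, more than the required 3/2 A q.\<close>
      have "A * q \<le> D / R\<^sup>2 \<or> A * q \<le> A * R"
      proof (cases "q \<le> R")
        case False
        have "A * q * R\<^sup>2 \<le> A * q * q\<^sup>2"
          using False Aq R by (intro mult_left_mono power_mono) auto
        with gt have "A * q * R\<^sup>2 \<le> D" by linarith
        then show ?thesis using R by (simp add: pos_le_divide_eq)
      qed (use A in \<open>auto intro: mult_left_mono\<close>)
      moreover have "0 < D / R\<^sup>2" "0 < A * R" using D A R by simp_all
      moreover have "f' s = - (3 / 2) * (A * q)" by (simp add: f'_def q_def)
      ultimately show ?thesis using Aq by linarith
    qed
    finally show "2 *\<^sub>R (B *v (y - 0)) \<noteq> 0 \<and>
        level_set_op (- A) (2 *\<^sub>R (B *v (y - 0))) (2 *\<^sub>R B) \<le> f' s"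
      using nz by blast
  next
    fix y s assume y: "y \<in> Q" "y \<notin> interior Q" and s: "s \<in> {0..<\<tau>}"
    have "s * sqrt s \<le> \<tau> * sqrt \<tau>"
      using s by (intro mult_mono) auto
    then have small: "A * (s * sqrt s) \<le> h\<^sup>2 / 4" using A \<tau> mult_left_mono[of _ "\<tau> * sqrt \<tau>" A] by (meson less_imp_le order_trans)
    show "\<psi> y s \<le> pos_cube C (U y s) + \<epsilon>"
    \<comment> \<open>On the rest of the boundary the coordinates have moduli at most h and at least
      3/2 h, whence U >= 9/4 h^2 - h^2 - 1/4 h^2 = h^2.\<close>
    proof (cases "\<bar>y $ 1\<bar> = h \<and> \<bar>y $ 2\<bar> \<le> 3 / 2 * h")
      case True
      then have "\<psi> y s \<le> 0" using lateral s by blast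
      then show ?thesis using pos_cube_nonneg[of C "U y s"] CK \<epsilon> by linarith
    next
      case False
      then have "\<bar>3 / 2 * h\<bar> \<le> \<bar>y $ 2\<bar>" "\<bar>y $ 1\<bar> \<le> \<bar>h\<bar>" using y h unfolding Q intQ by linarith+
      then have "(3 / 2 * h)\<^sup>2 \<le> (y $ 2)\<^sup>2" "(y $ 1)\<^sup>2 \<le> h\<^sup>2" unfolding abs_le_square_iff .
      then have "h\<^sup>2 \<le> U y s" using small unfolding U power_mult_distrib by (simp add: power_divide)
      then have "K \<le> pos_cube C (U y s)"
        using K h CK by (intro pos_cube_ge[of _ "h\<^sup>2"]) auto
      then show ?thesis using bound[of s y] s \<epsilon> by (auto simp: K_def)
    qed
  next
    fix y assume y: "y \<in> Q"
    show "\<psi> y 0 \<le> pos_cube C (U y 0) + \<epsilon>"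
    proof (cases "\<epsilon> \<le> \<psi> y 0")
      case True
      then have "\<delta> \<le> U y 0" using \<delta>(2) y by simp
      then have "K \<le> pos_cube C (U y 0)"
        using K \<delta> CK by (intro pos_cube_ge[of _ \<delta>]) auto
      then show ?thesis using bound[of 0 y] t \<epsilon> by (auto simp: K_def)
    qed (use pos_cube_nonneg[of C "U y 0"] CK in linarith)
  next
    show "compact Q" by (simp add: Q_def)
    show "x \<in> Q" using x by (simp add: Q)
  qed (use CK \<epsilon> t in auto)
  moreover have "U x t \<le> 0" using x by (simp add: U)
  ultimately show "\<psi> x t \<le> 0 + \<epsilon>" by (simp add: pos_cube_def)
qed

section \<open>The distance to a moving curve\<close>

text \<open>Only the regularity in \<open>classical_evolution\<close> is kept, with a two-sided time
  derivative; the law of motion is carried separately.\<close>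

definition curve_family ::
  "real set \<Rightarrow> (real \<Rightarrow> real \<Rightarrow> real^2) \<Rightarrow> (real \<Rightarrow> real \<Rightarrow> real^2) \<Rightarrow> (real \<Rightarrow> real \<Rightarrow> real^2)
     \<Rightarrow> (real \<Rightarrow> real \<Rightarrow> real^2) \<Rightarrow> bool" where
  "curve_family J \<gamma> \<gamma>s \<gamma>ss \<gamma>t \<longleftrightarrow>
     (\<forall>s. \<forall>t\<in>J.
        ((\<lambda>r. \<gamma> r t) has_vector_derivative \<gamma>s s t) (at s) \<and>
        ((\<lambda>r. \<gamma>s r t) has_vector_derivative \<gamma>ss s t) (at s) \<and>
        ((\<lambda>r. \<gamma> s r) has_vector_derivative \<gamma>t s t) (at t)) \<and>
     continuous_on (UNIV \<times> J) (\<lambda>z. \<gamma>s (fst z) (snd z)) \<and>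
     continuous_on (UNIV \<times> J) (\<lambda>z. \<gamma>ss (fst z) (snd z)) \<and>
     continuous_on (UNIV \<times> J) (\<lambda>z. \<gamma>t (fst z) (snd z))"

text \<open>Partial derivatives yield total differentiability because one of them,
  \<open>\<gamma>t\<close>, is jointly continuous.\<close>

lemma curve_family_has_derivative:
  assumes cf: "curve_family J \<gamma> \<gamma>s \<gamma>ss \<gamma>t" and J: "open J" "convex J" and t: "t \<in> J"
  shows "((\<lambda>z. \<gamma> (fst z) (snd z)) has_derivative (\<lambda>h. fst h *\<^sub>R \<gamma>s s t + snd h *\<^sub>R \<gamma>t s t)) (at (s, t))"
proof -
  have "((\<lambda>(x, y). \<gamma> x y) has_derivative
      (\<lambda>(tx, ty). tx *\<^sub>R \<gamma>s s t + blinfun_apply (blinfun_scaleR_left (\<gamma>t s t)) ty)) (at (s, t) within UNIV \<times> J)"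
  proof (rule has_derivative_partialsI)
    show "((\<lambda>x. \<gamma> x t) has_derivative (\<lambda>tx. tx *\<^sub>R \<gamma>s s t)) (at s within UNIV)"
      using cf t by (auto simp: curve_family_def has_vector_derivative_def)
    show "((\<lambda>y. \<gamma> x y) has_derivative blinfun_apply (blinfun_scaleR_left (\<gamma>t x y))) (at y within J)"
      if "y \<in> J" for x y
      using cf that by (auto simp: curve_family_def has_vector_derivative_def intro: has_derivative_at_withinI)
    have "continuous_on (UNIV \<times> J) (\<lambda>z. blinfun_scaleR_left (\<gamma>t (fst z) (snd z)))"
      using cf unfolding curve_family_def
      by (intro bounded_linear.continuous_on[OF bounded_linear_blinfun_scaleR_left]) blast
    then show "continuous (at (s, t) within UNIV \<times> J) (\<lambda>(x, y). blinfun_scaleR_left (\<gamma>t x y))"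
      using t unfolding case_prod_beta continuous_on_eq_continuous_within by blast
  qed (use t J in auto)
  moreover have "at (s, t) within UNIV \<times> J = at (s, t)"
    using J t by (intro at_within_open) (auto intro: open_Times)
  ultimately show ?thesis by (simp add: case_prod_unfold)
qed

text \<open>The point of the curve used at \<open>x\<close> is \<open>\<gamma>(\<sigma> + k \<bullet> (x - x0), t)\<close>. If \<open>k\<close> is dual to the
  tangent, it moves parallel to \<open>x\<close> to first order; then the level line of the distance
  through \<open>x0\<close> is to second order a translate of the curve, and no curvature is lost.\<close>

lemma test_function_on_curve_dist:
  fixes \<gamma> \<gamma>s \<gamma>ss \<gamma>t :: "real \<Rightarrow> real \<Rightarrow> real^2" and k x0 :: "real^2" and \<sigma> :: real
  defines "S \<equiv> \<lambda>x. \<sigma> + k \<bullet> (x - x0)"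
  defines "r \<equiv> \<lambda>x t. x - \<gamma> (S x) t"
  assumes cf: "curve_family J \<gamma> \<gamma>s \<gamma>ss \<gamma>t" and J: "open J" "convex J"
  shows "test_function_on J (\<lambda>x t. (norm (r x t))\<^sup>2) (\<lambda>x t. - 2 * (r x t \<bullet> \<gamma>t (S x) t))
    (\<lambda>x t. 2 *\<^sub>R (r x t - (r x t \<bullet> \<gamma>s (S x) t) *\<^sub>R k))
    (\<lambda>x t. 2 *\<^sub>R (mat 1 - outer_prod (\<gamma>s (S x) t) k - outer_prod k (\<gamma>s (S x) t)
       + (\<gamma>s (S x) t \<bullet> \<gamma>s (S x) t - r x t \<bullet> \<gamma>ss (S x) t) *\<^sub>R outer_prod k k))"
proof -
  have d\<gamma>: "((\<lambda>z. \<gamma> (fst z) (snd z)) has_derivative (\<lambda>h. fst h *\<^sub>R \<gamma>s s t + snd h *\<^sub>R \<gamma>t s t)) (at (s, t))"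
    if "t \<in> J" for s t
    using curve_family_has_derivative[OF cf J that] .
  have dr: "((\<lambda>z. r (fst z) (snd z)) has_derivative
      (\<lambda>h. fst h - (k \<bullet> fst h) *\<^sub>R \<gamma>s (S x) t - snd h *\<^sub>R \<gamma>t (S x) t)) (at (x, t))"
    if t: "t \<in> J" for x t
  proof -
    have "((\<lambda>z. (S (fst z), snd z)) has_derivative (\<lambda>h. (k \<bullet> fst h, snd h))) (at (x, t))"
      unfolding S_def by (auto intro!: derivative_eq_intros)
    from has_derivative_compose[OF this, of "\<lambda>z. \<gamma> (fst z) (snd z)"
        "\<lambda>h. fst h *\<^sub>R \<gamma>s (S x) t + snd h *\<^sub>R \<gamma>t (S x) t"]
    have "((\<lambda>z. \<gamma> (S (fst z)) (snd z)) has_derivative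
        (\<lambda>h. (k \<bullet> fst h) *\<^sub>R \<gamma>s (S x) t + snd h *\<^sub>R \<gamma>t (S x) t)) (at (x, t))"
      using d\<gamma>[OF t] by simp
    then show ?thesis
      unfolding r_def by (auto intro!: derivative_eq_intros simp: algebra_simps)
  qed
  have cS: "continuous_on (UNIV \<times> J) (\<lambda>z. f (S (fst z)) (snd z))"
    if "continuous_on (UNIV \<times> J) (\<lambda>z. f (fst z) (snd z))" for f :: "real \<Rightarrow> real \<Rightarrow> real^2"
  proof -
    have "continuous_on (UNIV \<times> J) (\<lambda>z. (S (fst z), snd z))"
      unfolding S_def by (intro continuous_intros)
    from continuous_on_compose2[OF that this] show ?thesis by (simp add: image_subset_iff mem_Times_iff)
  qed
  have c: "continuous_on (UNIV \<times> J) (\<lambda>z. \<gamma>s (S (fst z)) (snd z))"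
      "continuous_on (UNIV \<times> J) (\<lambda>z. \<gamma>ss (S (fst z)) (snd z))"
      "continuous_on (UNIV \<times> J) (\<lambda>z. \<gamma>t (S (fst z)) (snd z))"
    using cf by (auto simp: curve_family_def intro!: cS)
  have "continuous (at z) (\<lambda>z. r (fst z) (snd z))" if "z \<in> UNIV \<times> J" for z
    using dr[of "snd z" "fst z"] that has_derivative_continuous by fastforce
  then have cr: "continuous_on (UNIV \<times> J) (\<lambda>z. r (fst z) (snd z))"
    by (intro continuous_at_imp_continuous_on) blast
  show ?thesis
    unfolding test_function_on_def
  proof (intro conjI allI ballI)
    fix x t assume t: "t \<in> J"
    show "((\<lambda>z. (norm (r (fst z) (snd z)))\<^sup>2) has_derivative
        (\<lambda>h. 2 *\<^sub>R (r x t - (r x t \<bullet> \<gamma>s (S x) t) *\<^sub>R k) \<bullet> fst h + - 2 * (r x t \<bullet> \<gamma>t (S x) t) * snd h)) (at (x, t))"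
      unfolding power2_norm_eq_inner
      by (rule has_derivative_eq_rhs[OF has_derivative_inner[OF dr[OF t] dr[OF t]]])
        (simp add: fun_eq_iff inner_diff_right inner_diff_left inner_commute algebra_simps)
    have "((\<lambda>y. (y, t)) has_derivative (\<lambda>h. (h, 0))) (at x)"
      by (auto intro!: derivative_eq_intros)
    from has_derivative_compose[OF this dr[OF t, of x]]
    have drx: "((\<lambda>y. r y t) has_derivative (\<lambda>h. h - (k \<bullet> h) *\<^sub>R \<gamma>s (S x) t)) (at x)" by simp
    have dS: "(S has_derivative (\<lambda>h. k \<bullet> h)) (at x)"
      unfolding S_def by (auto intro!: derivative_eq_intros)
    have "((\<lambda>s. \<gamma>s s t) has_derivative (\<lambda>h. h *\<^sub>R \<gamma>ss (S x) t)) (at (S x))"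
      using cf t by (auto simp: curve_family_def has_vector_derivative_def)
    from has_derivative_compose[OF dS this]
    have ds: "((\<lambda>y. \<gamma>s (S y) t) has_derivative (\<lambda>h. (k \<bullet> h) *\<^sub>R \<gamma>ss (S x) t)) (at x)" .
    show "((\<lambda>y. 2 *\<^sub>R (r y t - (r y t \<bullet> \<gamma>s (S y) t) *\<^sub>R k)) has_derivative
        (\<lambda>h. (2 *\<^sub>R (mat 1 - outer_prod (\<gamma>s (S x) t) k - outer_prod k (\<gamma>s (S x) t)
          + (\<gamma>s (S x) t \<bullet> \<gamma>s (S x) t - r x t \<bullet> \<gamma>ss (S x) t) *\<^sub>R outer_prod k k)) *v h)) (at x)"
      by (rule has_derivative_eq_rhs[OF has_derivative_scaleR_right[OF has_derivative_diff[OF drx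
              has_derivative_scaleR_left[OF has_derivative_inner[OF drx ds]]]]])
        (simp add: fun_eq_iff matrix_vector_mult_add_rdistrib matrix_vector_mult_diff_rdistrib
          matrix_vec_scaleR outer_prod_mult_vec inner_diff_left inner_commute algebra_simps)
  next
    show "continuous_on (UNIV \<times> J) (\<lambda>z. - 2 * (r (fst z) (snd z) \<bullet> \<gamma>t (S (fst z)) (snd z)))"
      by (intro continuous_intros cr c)
    show "continuous_on (UNIV \<times> J) (\<lambda>z. 2 *\<^sub>R (r (fst z) (snd z)
        - (r (fst z) (snd z) \<bullet> \<gamma>s (S (fst z)) (snd z)) *\<^sub>R k))"
      by (intro continuous_intros cr c)
    show "continuous_on (UNIV \<times> J) (\<lambda>z. 2 *\<^sub>R (mat 1 - outer_prod (\<gamma>s (S (fst z)) (snd z)) k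
        - outer_prod k (\<gamma>s (S (fst z)) (snd z))
        + (\<gamma>s (S (fst z)) (snd z) \<bullet> \<gamma>s (S (fst z)) (snd z)
          - r (fst z) (snd z) \<bullet> \<gamma>ss (S (fst z)) (snd z)) *\<^sub>R outer_prod k k))"
      unfolding outer_prod_def
      by (intro continuous_intros cr c continuous_on_vec_lambda)
  qed
qed

text \<open>The fourth power is C u^2 of the squared distance, which makes contact at distance 0
  degenerate. At positive distance the second alternative of \<open>cases\<close> compares the
  normal velocity of the curve with the law at the foot point of \<open>x0\<close>.\<close>

lemma curve_no_touching:
  fixes \<psi> :: "real^2 \<Rightarrow> real \<Rightarrow> real"
  assumes sub: "viscosity_subsolution A \<psi>" and cf: "curve_family {0<..<\<tau>} \<gamma> \<gamma>s \<gamma>ss \<gamma>t"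
    and t0: "t0 \<in> {0<..<\<tau>}" and \<eta>: "0 < \<eta>" and C: "0 < C"
    and nz: "\<gamma>s \<sigma> t0 \<noteq> 0"
    and cases: "x0 = \<gamma> \<sigma> t0 \<or> (x0 - \<gamma> \<sigma> t0) \<bullet> \<gamma>s \<sigma> t0 = 0 \<and>
      - ((x0 - \<gamma> \<sigma> t0) \<bullet> \<gamma>ss \<sigma> t0) / (norm (\<gamma>s \<sigma> t0))\<^sup>2 + A * norm (x0 - \<gamma> \<sigma> t0) \<le> - ((x0 - \<gamma> \<sigma> t0) \<bullet> \<gamma>t \<sigma> t0)"
    and max: "\<forall>\<^sub>F z in nhds (x0, t0). \<forall>s.
      \<psi> (fst z) (snd z) - C * norm (fst z - \<gamma> s (snd z)) ^ 4 - \<eta> / (\<tau> - snd z)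
        \<le> \<psi> x0 t0 - C * norm (x0 - \<gamma> \<sigma> t0) ^ 4 - \<eta> / (\<tau> - t0)"
  shows False
proof -
  \<comment> \<open>Division by the squared length makes \<open>k\<close> dual to the tangent, that
    is, k \<bullet> \<open>\<gamma>s\<close> = 1 at the foot point.\<close>
  define k where "k = (1 / (norm (\<gamma>s \<sigma> t0))\<^sup>2) *\<^sub>R \<gamma>s \<sigma> t0"
  define S where "S = (\<lambda>x. \<sigma> + k \<bullet> (x - x0))"
  define r where "r = (\<lambda>x t. x - \<gamma> (S x) t)"
  define g where "g = (\<lambda>x t. 2 *\<^sub>R (r x t - (r x t \<bullet> \<gamma>s (S x) t) *\<^sub>R k))"
  define H where "H = (\<lambda>x t. 2 *\<^sub>R (mat 1 - outer_prod (\<gamma>s (S x) t) k - outer_prod k (\<gamma>s (S x) t)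
       + (\<gamma>s (S x) t \<bullet> \<gamma>s (S x) t - r x t \<bullet> \<gamma>ss (S x) t) *\<^sub>R outer_prod k k))"
  have tf: "test_function_on {0<..<\<tau>} (\<lambda>x t. (norm (r x t))\<^sup>2) (\<lambda>x t. - 2 * (r x t \<bullet> \<gamma>t (S x) t)) g H"
    unfolding g_def H_def r_def S_def by (rule test_function_on_curve_dist[OF cf]) auto
  have S0: "S x0 = \<sigma>" and r0: "r x0 t0 = x0 - \<gamma> \<sigma> t0" by (simp_all add: S_def r_def)
  have norm4: "n ^ 4 = (n\<^sup>2)\<^sup>2" for n :: real by simp
  show False
  proof (rule no_touching[OF sub tf, of "\<lambda>u. C * u\<^sup>2" "\<lambda>u. 2 * C * u" "\<lambda>u. 2 * C" t0 \<eta> x0])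
    show "\<forall>\<^sub>F z in nhds (x0, t0). \<psi> (fst z) (snd z) - C * ((norm (r (fst z) (snd z)))\<^sup>2)\<^sup>2 - \<eta> / (\<tau> - snd z)
      \<le> \<psi> x0 t0 - C * ((norm (r x0 t0))\<^sup>2)\<^sup>2 - \<eta> / (\<tau> - t0)"
      using max unfolding norm4[symmetric] r0 by (rule eventually_mono) (simp add: r_def)
    show "2 * C * (norm (r x0 t0))\<^sup>2 = 0 \<and> (2 * C = 0 \<or> g x0 t0 = 0) \<or>
      0 < 2 * C * (norm (r x0 t0))\<^sup>2 \<and> g x0 t0 \<noteq> 0 \<and>
      level_set_op A (g x0 t0) (H x0 t0) \<le> - 2 * (r x0 t0 \<bullet> \<gamma>t (S x0) t0)"
    proof (cases "r x0 t0 = 0")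
      \<comment> \<open>At distance 0 the second derivative 2 C does not vanish, but the gradient
        \<open>g\<close> does, which is the other way to be degenerate.\<close>
      case True
      then show ?thesis by (simp add: g_def)
    next
      case False
      define R \<tau>' N where "R = x0 - \<gamma> \<sigma> t0" and "\<tau>' = \<gamma>s \<sigma> t0" and "N = (norm (\<gamma>s \<sigma> t0))\<^sup>2"
      have N: "0 < N" "\<tau>' \<bullet> \<tau>' = N" using nz by (simp_all add: N_def \<tau>'_def power2_norm_eq_inner)
      have R: "R \<noteq> 0" "r x0 t0 = R" using False r0 by (simp_all add: R_def)
      have c: "R \<bullet> \<tau>' = 0" "- (R \<bullet> \<gamma>ss \<sigma> t0) / N + A * norm R \<le> - (R \<bullet> \<gamma>t \<sigma> t0)"
        using cases R r0 by (auto simp: R_def \<tau>'_def N_def)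
      have k: "k = (1 / N) *\<^sub>R \<tau>'" by (simp add: k_def N_def \<tau>'_def)
      have g: "g x0 t0 = 2 *\<^sub>R R" by (simp add: g_def S0 R c \<tau>'_def[symmetric])
      have H: "H x0 t0 = 2 *\<^sub>R (mat 1 - outer_prod \<tau>' k - outer_prod k \<tau>' + (N - R \<bullet> \<gamma>ss \<sigma> t0) *\<^sub>R outer_prod k k)"
        by (simp add: H_def S0 R \<tau>'_def[symmetric] N)
      have kk: "\<tau>' \<bullet> k = 1" "k \<bullet> \<tau>' = 1" "k \<bullet> k = 1 / N" "k \<bullet> R = 0" "R \<bullet> k = 0" "\<tau>' \<bullet> R = 0"
        using N c by (simp_all add: k inner_commute)
      have tr: "trace (H x0 t0) = 2 - 2 * (R \<bullet> \<gamma>ss \<sigma> t0) / N"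
        unfolding H using N kk
        by (simp add: trace_scaleR trace_add trace_sub trace_outer_prod trace_I)
          (simp add: field_simps)
      \<comment> \<open>The vector \<open>R\<close> is orthogonal to the tangent, hence an
        eigenvector of the Hessian for the eigenvalue 2. This cancels the constant 2 in the trace
        and leaves just the curvature of the curve.\<close>
      have HR: "H x0 t0 *v (2 *\<^sub>R R) = 4 *\<^sub>R R"
        unfolding H using kk
        by (simp add: matrix_vec_scaleR matrix_vector_mult_add_rdistrib matrix_vector_mult_diff_rdistrib
            outer_prod_mult_vec matrix_vector_mult_scaleR)
      have "level_set_op A (g x0 t0) (H x0 t0) = 2 * (- (R \<bullet> \<gamma>ss \<sigma> t0) / N + A * norm R)"
        unfolding level_set_op_eq g HR tr using R
        by (simp add: power_mult_distrib power2_norm_eq_inner)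
      also have "\<dots> \<le> - 2 * (R \<bullet> \<gamma>t \<sigma> t0)" using c by simp
      finally show ?thesis using R C g by (simp add: S0)
    qed
  qed (use t0 \<eta> in \<open>auto intro!: derivative_eq_intros\<close>)
qed

text \<open>The modulus of the first coordinate adds the mirror image. Since the inequality with
  \<open>a t\<close> is strict, the axis is excluded when a t >= 0 and the two halves are
  disjoint.\<close>

definition open_region :: "(real \<Rightarrow> real) \<Rightarrow> (real \<Rightarrow> real) \<Rightarrow> (real \<Rightarrow> real \<Rightarrow> real) \<Rightarrow> real \<Rightarrow> (real^2) set" where
  "open_region a b v t = {z. a t < \<bar>z $ 1\<bar> \<and> \<bar>z $ 1\<bar> < b t \<and> \<bar>z $ 2\<bar> < v \<bar>z $ 1\<bar> t}"

definition closed_region :: "(real \<Rightarrow> real) \<Rightarrow> (real \<Rightarrow> real) \<Rightarrow> (real \<Rightarrow> real \<Rightarrow> real) \<Rightarrow> real \<Rightarrow> (real^2) set" where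
  "closed_region a b v t = {z. a t \<le> \<bar>z $ 1\<bar> \<and> \<bar>z $ 1\<bar> \<le> b t \<and> \<bar>z $ 2\<bar> \<le> v \<bar>z $ 1\<bar> t}"

text \<open>Closedness jointly in space and time provides compactness for the later maximisation and
  lets a point off the region be held fixed for nearby times. As \<open>v\<close> is continuous over
  the moving interval only, the complement of the open region is assembled from three closed
  pieces.\<close>

lemma closed_regions:
  assumes a: "continuous_on {0..t'} a" and b: "continuous_on {0..t'} b"
    and v: "continuous_on {(x, t). t \<in> {0..t'} \<and> x \<in> {a t..b t}} (\<lambda>z. v (fst z) (snd z))"
  shows "closed {w. snd w \<in> {0..t'} \<and> fst w \<in> closed_region a b v (snd w)}"
    and "closed {w. snd w \<in> {0..t'} \<and> fst w \<notin> open_region a b v (snd w)}"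
proof -
  let ?P = "UNIV \<times> {0..t'} :: ((real^2) \<times> real) set"
  have P: "closed ?P" by (intro closed_Times) auto
  have ca: "continuous_on ?P (\<lambda>w. \<bar>fst w $ 1\<bar> - a (snd w))"
    and cb: "continuous_on ?P (\<lambda>w. b (snd w) - \<bar>fst w $ 1\<bar>)"
    by (auto intro!: continuous_intros continuous_on_compose2[OF a] continuous_on_compose2[OF b])
  let ?V = "(?P \<inter> (\<lambda>w. \<bar>fst w $ 1\<bar> - a (snd w)) -` {0..}) \<inter> (?P \<inter> (\<lambda>w. b (snd w) - \<bar>fst w $ 1\<bar>) -` {0..})"
  let ?A = "?P \<inter> (\<lambda>w. \<bar>fst w $ 1\<bar> - a (snd w)) -` {..0}"
  let ?B = "?P \<inter> (\<lambda>w. b (snd w) - \<bar>fst w $ 1\<bar>) -` {..0}"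
  have V: "closed ?V"
    using P ca cb by (intro closed_Int continuous_closed_preimage) auto
  have AB: "closed ?A" "closed ?B"
    using P ca cb by (intro continuous_closed_preimage; simp)+
  have "continuous_on ?V (\<lambda>w. (\<bar>fst w $ 1\<bar>, snd w))"
    by (intro continuous_intros)
  moreover have "(\<lambda>w. (\<bar>fst w $ 1\<bar>, snd w)) ` ?V \<subseteq> {(x, t). t \<in> {0..t'} \<and> x \<in> {a t..b t}}"
    by auto
  ultimately have "continuous_on ?V (\<lambda>w. v \<bar>fst w $ 1\<bar> (snd w))"
    using continuous_on_compose2[OF v] by fastforce
  then have cv: "continuous_on ?V (\<lambda>w. v \<bar>fst w $ 1\<bar> (snd w) - \<bar>fst w $ 2\<bar>)"
    by (intro continuous_intros)
  have "closed (?V \<inter> (\<lambda>w. v \<bar>fst w $ 1\<bar> (snd w) - \<bar>fst w $ 2\<bar>) -` {0..})"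
    using cv V by (intro continuous_closed_preimage) auto
  also have "?V \<inter> (\<lambda>w. v \<bar>fst w $ 1\<bar> (snd w) - \<bar>fst w $ 2\<bar>) -` {0..}
      = {w. snd w \<in> {0..t'} \<and> fst w \<in> closed_region a b v (snd w)}"
    by (auto simp: closed_region_def)
  finally show "closed {w. snd w \<in> {0..t'} \<and> fst w \<in> closed_region a b v (snd w)}" .
  have "closed (?V \<inter> (\<lambda>w. v \<bar>fst w $ 1\<bar> (snd w) - \<bar>fst w $ 2\<bar>) -` {..0})"
    using cv V by (intro continuous_closed_preimage) auto
  with AB have "closed (?A \<union> (?B \<union> (?V \<inter> (\<lambda>w. v \<bar>fst w $ 1\<bar> (snd w) - \<bar>fst w $ 2\<bar>) -` {..0})))"
    by (intro closed_Un)
  also have "?A \<union> (?B \<union> (?V \<inter> (\<lambda>w. v \<bar>fst w $ 1\<bar> (snd w) - \<bar>fst w $ 2\<bar>) -` {..0}))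
      = {w. snd w \<in> {0..t'} \<and> fst w \<notin> open_region a b v (snd w)}"
    by (auto simp: open_region_def)
  finally show "closed {w. snd w \<in> {0..t'} \<and> fst w \<notin> open_region a b v (snd w)}" .
qed

text \<open>Leaving the region under the graph means crossing the curve, so the component of
  \<open>z\<close> in the complement of the curve stays bounded. This decides which way the outer
  normal points.\<close>

lemma graph_curve_inside:
  assumes v: "continuous_on {a..b} v" and ends: "v a = 0" "v b = 0" and ab: "a < b"
    and z: "a < z $ 1" "z $ 1 < b" "\<bar>z $ 2\<bar> < v (z $ 1)"
  shows "z \<notin> outside (graph_curve a b v)"
proof
  let ?I = "{z :: real^2. a < z $ 1 \<and> z $ 1 < b \<and> \<bar>z $ 2\<bar> < v (z $ 1)}"
  let ?K = "{z :: real^2. a \<le> z $ 1 \<and> z $ 1 \<le> b \<and> \<bar>z $ 2\<bar> \<le> v (z $ 1)}"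
  let ?G = "graph_curve a b v"
  let ?W = "{z :: real^2. a < z $ 1} \<inter> {z. z $ 1 < b}"
  let ?V = "{z :: real^2. a \<le> z $ 1} \<inter> {z. z $ 1 \<le> b}"
  assume out: "z \<in> outside ?G"
  have cV: "continuous_on ?V (\<lambda>z. v (z $ 1) - \<bar>z $ 2\<bar>)"
    by (intro continuous_intros continuous_on_compose2[OF v]) auto
  have "open ?W" by (intro open_Int open_Collect_less continuous_intros)
  then have "open (?W \<inter> (\<lambda>z. v (z $ 1) - \<bar>z $ 2\<bar>) -` {0<..})"
    by (intro continuous_open_preimage continuous_on_subset[OF cV]) auto
  also have "?W \<inter> (\<lambda>z. v (z $ 1) - \<bar>z $ 2\<bar>) -` {0<..} = ?I" by auto
  finally have I: "open ?I" .
  have "closed ?V" by (intro closed_Int closed_Collect_le continuous_intros)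
  then have "closed (?V \<inter> (\<lambda>z. v (z $ 1) - \<bar>z $ 2\<bar>) -` {0..})"
    by (intro continuous_closed_preimage cV) auto
  also have "?V \<inter> (\<lambda>z. v (z $ 1) - \<bar>z $ 2\<bar>) -` {0..} = ?K" by auto
  finally have K: "closed ?K" .
  have GK: "w \<in> ?G" if "w \<in> ?K" "w \<notin> ?I" for w
    using that ends by (auto simp: graph_curve_def order.order_iff_strict)
  let ?c = "connected_component_set (- ?G) z"
  have "z \<notin> ?G" using z by (auto simp: graph_curve_def)
  then have zc: "z \<in> ?c" by simp
  have sub: "?c \<subseteq> - ?G" by (rule connected_component_subset)
  \<comment> \<open>Points of \<open>?K\<close> outside \<open>?I\<close> lie on the curve, so the
    open sets \<open>?I\<close> and \<open>- ?K\<close> cover the component, which is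
    connected.\<close>
  have "?I \<inter> ?c = {} \<or> - ?K \<inter> ?c = {}"
    using K I sub GK by (intro connectedD[OF connected_connected_component]) auto
  then have "?c \<subseteq> ?K" using zc z by auto
  moreover have "bounded ?K"
  proof -
    have "compact (v ` {a..b})" by (intro compact_continuous_image v) auto
    then obtain B where "\<forall>y\<in>v ` {a..b}. norm y \<le> B"
      using compact_imp_bounded bounded_iff by blast
    then have B: "\<bar>v x\<bar> \<le> B" if "x \<in> {a..b}" for x using that by auto
    have "norm w \<le> \<bar>a\<bar> + \<bar>b\<bar> + B" if "w \<in> ?K" for w
    proof -
      have "norm w \<le> \<bar>w $ 1\<bar> + \<bar>w $ 2\<bar>" using norm_le_l1_cart[of w] by (simp add: sum_2)
      moreover have "\<bar>w $ 2\<bar> \<le> B" using that B[of "w $ 1"] by auto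
      ultimately show ?thesis using that by auto
    qed
    then show ?thesis by (rule boundedI)
  qed
  ultimately have "bounded ?c" using bounded_subset by blast
  then show False using out by (simp add: outside_def)
qed

section \<open>Reflection in the axis and orthogonality in the plane\<close>

definition mirror :: "real \<Rightarrow> real^2 \<Rightarrow> real^2" where
  "mirror e z = vector [e * z $ 1, z $ 2]"

lemma mirror_nth [simp]: "mirror e z $ 1 = e * z $ 1" "mirror e z $ 2 = z $ 2"
  by (simp_all add: mirror_def)

lemma bounded_linear_mirror: "bounded_linear (mirror e)"
  by (intro linear_conv_bounded_linear[THEN iffD1] linearI)
    (simp_all add: vec_eq_iff forall_2 algebra_simps)

lemma mirror_isometry:
  assumes "e\<^sup>2 = 1"
  shows "mirror e v \<bullet> mirror e w = v \<bullet> w" "mirror e (mirror e v) = v" "norm (mirror e v) = norm v"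
proof -
  have ee: "e * e = 1" using assms by (simp add: power2_eq_square)
  have e: "e * x * (e * y) = x * y" "e * (e * x) = x" for x y
    using arg_cong[OF ee, of "\<lambda>r. r * (x * y)"] arg_cong[OF ee, of "\<lambda>r. r * x"]
    by (simp_all only: mult_ac mult_1_left mult_1_right)
  show inner: "mirror e v \<bullet> mirror e w = v \<bullet> w" for v w
    using e by (simp add: inner_real2)
  show "norm (mirror e v) = norm v" by (simp add: norm_eq_sqrt_inner inner)
  show "mirror e (mirror e v) = v"
    using e by (simp add: vec_eq_iff forall_2)
qed

lemma curve_family_mirror:
  assumes "curve_family J \<gamma> \<gamma>s \<gamma>ss \<gamma>t"
  shows "curve_family J (\<lambda>s t. mirror e (\<gamma> s t)) (\<lambda>s t. mirror e (\<gamma>s s t))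
    (\<lambda>s t. mirror e (\<gamma>ss s t)) (\<lambda>s t. mirror e (\<gamma>t s t))"
  using assms unfolding curve_family_def
  by (auto intro!: bounded_linear.has_vector_derivative[OF bounded_linear_mirror]
      bounded_linear.continuous_on[OF bounded_linear_mirror])

text \<open>The cross product of \<open>R\<close> and \<open>n\<close> vanishes: multiplied by
  either coordinate of \<open>w\<close> it is a combination of the two orthogonality
  relations.\<close>

lemma orthogonal_real2:
  fixes R n w :: "real^2"
  assumes "w \<noteq> 0" "R \<bullet> w = 0" "n \<bullet> w = 0" "norm n = 1"
  shows "R = (R \<bullet> n) *\<^sub>R n"
proof -
  have n: "n $ 1 * n $ 1 + n $ 2 * n $ 2 = 1"
    using assms(4) by (simp add: norm_eq_1 inner_real2)
  have R: "R $ 1 * w $ 1 + R $ 2 * w $ 2 = 0" and N: "n $ 1 * w $ 1 + n $ 2 * w $ 2 = 0"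
    using assms by (simp_all add: inner_real2)
  have "(R $ 1 * n $ 2 - R $ 2 * n $ 1) * w $ 1
      = n $ 2 * (R $ 1 * w $ 1 + R $ 2 * w $ 2) - R $ 2 * (n $ 1 * w $ 1 + n $ 2 * w $ 2)"
    "(R $ 1 * n $ 2 - R $ 2 * n $ 1) * w $ 2
      = R $ 1 * (n $ 1 * w $ 1 + n $ 2 * w $ 2) - n $ 1 * (R $ 1 * w $ 1 + R $ 2 * w $ 2)"
    by (simp_all add: algebra_simps)
  then have "(R $ 1 * n $ 2 - R $ 2 * n $ 1) * w $ 1 = 0" "(R $ 1 * n $ 2 - R $ 2 * n $ 1) * w $ 2 = 0"
    unfolding R N by simp_all
  then have cross: "R $ 1 * n $ 2 = R $ 2 * n $ 1"
    using assms(1) by (auto simp: vec_eq_iff forall_2)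
  have "(R $ 1 * n $ 1 + R $ 2 * n $ 2) * n $ 1
      = R $ 1 * (n $ 1 * n $ 1 + n $ 2 * n $ 2) - n $ 2 * (R $ 1 * n $ 2 - R $ 2 * n $ 1)"
    "(R $ 1 * n $ 1 + R $ 2 * n $ 2) * n $ 2
      = R $ 2 * (n $ 1 * n $ 1 + n $ 2 * n $ 2) + n $ 1 * (R $ 1 * n $ 2 - R $ 2 * n $ 1)"
    by (simp_all add: algebra_simps)
  then have "(R $ 1 * n $ 1 + R $ 2 * n $ 2) * n $ 1 = R $ 1" "(R $ 1 * n $ 1 + R $ 2 * n $ 2) * n $ 2 = R $ 2"
    unfolding n cross by simp_all
  then show ?thesis by (simp add: vec_eq_iff forall_2 inner_real2)
qed

lemma classical_evolution_curve_family:
  assumes "classical_evolution A T \<Lambda>"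
  obtains \<gamma> \<gamma>s \<gamma>ss \<gamma>t where "curve_family {0<..<T} \<gamma> \<gamma>s \<gamma>ss \<gamma>t"
    "\<And>t. t \<in> {0<..<T} \<Longrightarrow> \<Lambda> t = range (\<lambda>s. \<gamma> s t)"
    "\<And>s t. t \<in> {0<..<T} \<Longrightarrow> \<gamma>s s t \<noteq> 0"
    "\<And>s t. t \<in> {0<..<T} \<Longrightarrow> \<exists>n. outer_normal (\<Lambda> t) (\<gamma> s t) (\<gamma>s s t) n \<and>
      \<gamma>t s t \<bullet> n = (\<gamma>ss s t \<bullet> n) / (norm (\<gamma>s s t))\<^sup>2 + A"
proof -
  obtain \<gamma> \<gamma>s \<gamma>ss \<gamma>t where d: "\<forall>s. \<forall>t\<in>{0..<T}.
           ((\<lambda>r. \<gamma> r t) has_vector_derivative \<gamma>s s t) (at s) \<and>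
           ((\<lambda>r. \<gamma>s r t) has_vector_derivative \<gamma>ss s t) (at s) \<and>
           ((\<lambda>r. \<gamma> s r) has_vector_derivative \<gamma>t s t) (at t within {0..<T})"
    and c: "continuous_on (UNIV \<times> {0..<T}) (\<lambda>z. \<gamma>s (fst z) (snd z))"
        "continuous_on (UNIV \<times> {0..<T}) (\<lambda>z. \<gamma>ss (fst z) (snd z))"
        "continuous_on (UNIV \<times> {0..<T}) (\<lambda>z. \<gamma>t (fst z) (snd z))"
    and rest: "\<forall>t\<in>{0..<T}.
           (\<forall>s. \<gamma> (s + 1) t = \<gamma> s t) \<and> inj_on (\<lambda>s. \<gamma> s t) {0..<1} \<and>
           (\<forall>s. \<gamma>s s t \<noteq> 0) \<and> \<Lambda> t = range (\<lambda>s. \<gamma> s t) \<and>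
           (\<forall>s. \<exists>n. outer_normal (\<Lambda> t) (\<gamma> s t) (\<gamma>s s t) n \<and>
              (let \<kappa> = - (\<gamma>ss s t \<bullet> n) / (norm (\<gamma>s s t))\<^sup>2 in \<gamma>t s t \<bullet> n = - \<kappa> + A))"
    using assms unfolding classical_evolution_def by blast
  have sub: "UNIV \<times> {0<..<T} \<subseteq> UNIV \<times> {0..<T}" by auto
  show thesis
  proof (rule that)
    show "curve_family {0<..<T} \<gamma> \<gamma>s \<gamma>ss \<gamma>t"
      unfolding curve_family_def
    proof (intro conjI allI ballI)
      fix s t assume t: "t \<in> {0<..<T}"
      then have "at t within {0..<T} = at t" by (intro at_within_interior) simp
      moreover have "t \<in> {0..<T}" using t by simp
      ultimately show "((\<lambda>r. \<gamma> r t) has_vector_derivative \<gamma>s s t) (at s)"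
        "((\<lambda>r. \<gamma>s r t) has_vector_derivative \<gamma>ss s t) (at s)"
        "((\<lambda>r. \<gamma> s r) has_vector_derivative \<gamma>t s t) (at t)"
        using d by metis+
    qed (rule continuous_on_subset[OF c(1) sub] continuous_on_subset[OF c(2) sub]
        continuous_on_subset[OF c(3) sub])+
  next
    fix s t assume "t \<in> {0<..<T}"
    then have "t \<in> {0..<T}" by simp
    then obtain n where "outer_normal (\<Lambda> t) (\<gamma> s t) (\<gamma>s s t) n"
      "\<gamma>t s t \<bullet> n = - (- (\<gamma>ss s t \<bullet> n) / (norm (\<gamma>s s t))\<^sup>2) + A"
      using rest by (metis (no_types, lifting))
    then show "\<exists>n. outer_normal (\<Lambda> t) (\<gamma> s t) (\<gamma>s s t) n \<and> \<gamma>t s t \<bullet> n = (\<gamma>ss s t \<bullet> n) / (norm (\<gamma>s s t))\<^sup>2 + A"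
      by (intro exI[of _ n]) simp
  qed (use rest in auto)
qed

section \<open>Comparison with the free planar flow\<close>

lemma free_planar_flow_continuous:
  assumes flow: "free_planar_flow A b0 u0 T v a b" and t': "t' < T"
  shows "continuous_on {0..t'} a" "continuous_on {0..t'} b"
    "continuous_on {(x, t). t \<in> {0..t'} \<and> x \<in> {a t..b t}} (\<lambda>z. v (fst z) (snd z))"
  using assms unfolding free_planar_flow_def
  by (auto elim!: continuous_on_subset)

text \<open>Any choice of \<open>q\<close> as a function of (x, t) that avoids the open region gives
  a test function. A point \<open>q0\<close> off the closed region is held fixed; a point
  \<open>q0\<close> on the boundary is moved along the curve as in
  \<open>curve_no_touching\<close>.\<close>

lemma no_global_max:
  fixes \<psi> :: "real^2 \<Rightarrow> real \<Rightarrow> real"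
  assumes sub: "viscosity_subsolution A \<psi>"
    and flow: "free_planar_flow A b0 u0 T v a b"
    and \<delta>: "0 < \<delta>" "\<delta> \<le> T" and a: "\<And>t. t \<in> {0<..<\<delta>} \<Longrightarrow> 0 \<le> a t"
    and C: "0 < C" and \<eta>: "0 < \<eta>"
    and t0: "t0 \<in> {0<..<\<delta>}" and q0: "q0 \<notin> open_region a b v t0"
    and max: "\<And>x q s. s \<in> {0<..<\<delta>} \<Longrightarrow> q \<notin> open_region a b v s \<Longrightarrow>
      \<psi> x s - C * norm (x - q) ^ 4 - \<eta> / (\<delta> - s) \<le> \<psi> x0 t0 - C * norm (x0 - q0) ^ 4 - \<eta> / (\<delta> - t0)"
  shows False
proof -
  have t0T: "t0 \<in> {0<..<T}" using t0 \<delta> by auto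
  \<comment> \<open>Maximality in \<open>q\<close> alone makes \<open>q0\<close> a point of the
    complement nearest to \<open>x0\<close>.\<close>
  have closest: "norm (x0 - q0) \<le> norm (x0 - q)" if "q \<notin> open_region a b v t0" for q
  proof -
    have "C * norm (x0 - q0) ^ 4 \<le> C * norm (x0 - q) ^ 4" using max[OF t0 that, of x0] by simp
    then have "norm (x0 - q0) ^ 4 \<le> norm (x0 - q) ^ 4" using C by simp
    then show ?thesis using power_mono_iff[of "norm (x0 - q0)" "norm (x0 - q)" 4] by simp
  qed
  \<comment> \<open>A point of the segment beyond \<open>q0\<close> that avoided the region would be
    strictly nearer to \<open>x0\<close>.\<close>
  have between: "q0 + l *\<^sub>R (x0 - q0) \<in> open_region a b v t0" if "0 < l" "l \<le> 1" "x0 \<noteq> q0" for l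
  proof (rule ccontr)
    assume "q0 + l *\<^sub>R (x0 - q0) \<notin> open_region a b v t0"
    from closest[OF this] have "norm (x0 - q0) \<le> norm ((1 - l) *\<^sub>R (x0 - q0))"
      by (simp add: algebra_simps)
    also have "\<dots> = (1 - l) * norm (x0 - q0)" using that by simp
    finally show False using that by (simp add: algebra_simps mult_le_0_iff)
  qed
  define t' where "t' = (t0 + \<delta>) / 2"
  have t': "t0 < t'" "t' < \<delta>" "t' < T" using t0 \<delta> by (auto simp: t'_def)
  note cl = closed_regions[OF free_planar_flow_continuous[OF flow t'(3)]]
  have v: "a t0 < b t0" "v (a t0) t0 = 0" "v (b t0) t0 = 0"
    and cv: "continuous_on {a t0..b t0} (\<lambda>x. v x t0)"
  proof -
    show "a t0 < b t0" "v (a t0) t0 = 0" "v (b t0) t0 = 0"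
      using flow t0T by (auto simp: free_planar_flow_def)
    have 1: "continuous_on {(x, t). t \<in> {0..<T} \<and> x \<in> {a t..b t}} (\<lambda>z. v (fst z) (snd z))"
      using flow by (auto simp: free_planar_flow_def)
    have 2: "continuous_on {a t0..b t0} (\<lambda>x. (x, t0))" by (intro continuous_intros)
    have 3: "(\<lambda>x. (x, t0)) ` {a t0..b t0} \<subseteq> {(x, t). t \<in> {0..<T} \<and> x \<in> {a t..b t}}"
      using t0T by auto
    from continuous_on_compose2[OF 1 2 3] show "continuous_on {a t0..b t0} (\<lambda>x. v x t0)" by simp
  qed
  show False
  proof (cases "q0 \<in> closed_region a b v t0")
    case False
    let ?N = "UNIV \<times> {0<..<t'} - {w. snd w \<in> {0..t'} \<and> fst w \<in> closed_region a b v (snd w)}"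
    have "open ?N" using cl(1) by (intro open_Diff open_Times) auto
    moreover have "(q0, t0) \<in> ?N" using False t0 t' by auto
    ultimately have ev: "\<forall>\<^sub>F w in nhds (q0, t0). w \<in> ?N" by (rule eventually_nhds_in_open)
    have out: "q \<notin> open_region a b v s" if "(q, s) \<in> ?N" for q s
      using that by (auto simp: open_region_def closed_region_def)
    \<comment> \<open>Otherwise the segment towards \<open>x0\<close> would start in the open
      region, although all points near \<open>q0\<close> lie off it.\<close>
    have x0: "x0 = q0"
    proof (rule ccontr)
      assume ne: "x0 \<noteq> q0"
      have "((\<lambda>l. (q0 + l *\<^sub>R (x0 - q0), t0)) \<longlongrightarrow> (q0, t0)) (at_right (0::real))"
        by (auto intro!: tendsto_eq_intros)
      with ev have "\<forall>\<^sub>F l in at_right 0. (q0 + l *\<^sub>R (x0 - q0), t0) \<in> ?N"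
        by (rule eventually_compose_filterlim)
      moreover have "\<forall>\<^sub>F l in at_right (0::real). 0 < l \<and> l \<le> 1"
        unfolding eventually_at_right_field by (intro exI[of _ 1]) auto
      ultimately have "\<forall>\<^sub>F l in at_right (0::real). False"
        by eventually_elim (use out between ne in blast)
      then show False by simp
    qed
    have "((\<lambda>z. (q0, snd z)) \<longlongrightarrow> (q0, t0)) (nhds (x0, t0))"
      using tendsto_snd[OF filterlim_ident[of "nhds (x0, t0)"]] by (intro tendsto_intros) simp
    with ev have "\<forall>\<^sub>F z in nhds (x0, t0). (q0, snd z) \<in> ?N"
      by (rule eventually_compose_filterlim)
    then have ev2: "\<forall>\<^sub>F z in nhds (x0, t0). \<psi> (fst z) (snd z) - C * norm (fst z - q0) ^ 4 - \<eta> / (\<delta> - snd z)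
        \<le> \<psi> x0 t0 - C * norm (x0 - q0) ^ 4 - \<eta> / (\<delta> - t0)"
      by (rule eventually_mono) (use out t' in \<open>auto intro!: max\<close>)
    have tf: "test_function_on {0<..<\<delta>} (\<lambda>x t. (x - q0) \<bullet> (mat 1 *v (x - q0)) + 0) (\<lambda>x t. 0)
        (\<lambda>x t. 2 *\<^sub>R (mat 1 *v (x - q0))) (\<lambda>x t. 2 *\<^sub>R mat 1)"
      by (rule test_function_on_quadratic) (auto simp: transpose_mat)
    have n4: "C * ((x - q0) \<bullet> (mat 1 *v (x - q0)) + 0)\<^sup>2 = C * norm (x - q0) ^ 4" for x
      by (simp add: power2_norm_eq_inner[symmetric])
    show False
      by (rule no_touching[OF sub tf, of "\<lambda>u. C * u\<^sup>2" "\<lambda>u. 2 * C * u" "\<lambda>u. 2 * C" t0 \<eta> x0, unfolded n4])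
        (use ev2 t0 \<eta> x0 in \<open>auto intro!: derivative_eq_intros\<close>)
  next
    case True
    obtain \<gamma> \<gamma>s \<gamma>ss \<gamma>t where cf: "curve_family {0<..<T} \<gamma> \<gamma>s \<gamma>ss \<gamma>t"
      and range: "\<And>t. t \<in> {0<..<T} \<Longrightarrow> graph_curve (a t) (b t) (\<lambda>x. v x t) = range (\<lambda>s. \<gamma> s t)"
      and nz: "\<And>s t. t \<in> {0<..<T} \<Longrightarrow> \<gamma>s s t \<noteq> 0"
      and normal: "\<And>s t. t \<in> {0<..<T} \<Longrightarrow>
        \<exists>n. outer_normal (graph_curve (a t) (b t) (\<lambda>x. v x t)) (\<gamma> s t) (\<gamma>s s t) n \<and>
          \<gamma>t s t \<bullet> n = (\<gamma>ss s t \<bullet> n) / (norm (\<gamma>s s t))\<^sup>2 + A"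
    proof -
      have "classical_evolution A T (\<lambda>t. graph_curve (a t) (b t) (\<lambda>x. v x t))"
        using flow by (simp add: free_planar_flow_def)
      then show thesis using that by (rule classical_evolution_curve_family) blast+
    qed
    \<comment> \<open>The sign selects the half that contains \<open>x0\<close>, or
      \<open>q0\<close> if both coincide; reflecting by \<open>e\<close> carries it to the right,
      where \<open>\<gamma>\<close> parametrises the boundary.\<close>
    define e :: real where "e = (if x0 = q0 then (if 0 \<le> q0 $ 1 then 1 else - 1)
      else (if 0 \<le> x0 $ 1 then 1 else - 1))"
    have e: "e\<^sup>2 = 1" "\<bar>e\<bar> = 1" by (auto simp: e_def)
    have a0: "0 \<le> a t0" using a[OF t0] .
    have x0_side: "0 < e * x0 $ 1" if "x0 \<noteq> q0"
    proof -
      have "x0 \<in> open_region a b v t0" using between[of 1] that by simp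
      then show ?thesis using that a0 by (auto simp: open_region_def e_def)
    qed
    have q0_side: "0 \<le> e * q0 $ 1"
    proof (cases "x0 = q0")
      case False
      show ?thesis
      proof (rule ccontr)
        assume neg: "\<not> 0 \<le> e * q0 $ 1"
        \<comment> \<open>If \<open>q0\<close> were on the other side, the segment to
          \<open>x0\<close> would meet the axis at parameter y / (y - z). Since a t0 >= 0 the axis
          is off the open region, contrary to \<open>between\<close>.\<close>
        define y z where "y = e * q0 $ 1" and "z = e * x0 $ 1"
        define l where "l = y / (y - z)"
        have yz: "y < 0" "0 < z" using neg x0_side[OF False] by (simp_all add: y_def z_def)
        then have l: "0 < l" "l \<le> 1" by (simp_all add: l_def divide_simps)
        have "l * (y - z) = y" using yz by (simp add: l_def)
        then have "e * (q0 + l *\<^sub>R (x0 - q0)) $ 1 = 0" by (simp add: y_def z_def algebra_simps)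
        then have "(q0 + l *\<^sub>R (x0 - q0)) $ 1 = 0" using e by auto
        then show False using between[OF l False] a0 by (simp add: open_region_def)
      qed
    qed (simp add: e_def)
    have abs_e: "\<bar>e * r\<bar> = \<bar>r\<bar>" for r using e by (simp add: abs_mult)
    have "mirror e q0 \<in> graph_curve (a t0) (b t0) (\<lambda>x. v x t0)"
      using True q0 q0_side v abs_e[of "q0 $ 1"]
      by (auto simp: graph_curve_def open_region_def closed_region_def order.order_iff_strict)
    then obtain \<sigma> where \<sigma>: "\<gamma> \<sigma> t0 = mirror e q0" using range[OF t0T] by auto
    \<comment> \<open>As a t >= 0 the curve stays in the closed right half plane, so neither it nor
      its mirror image enters the open region.\<close>
    have on_curve: "mirror e (\<gamma> s t) \<notin> open_region a b v t" if "t \<in> {0<..<\<delta>}" for s t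
    proof -
      have "\<gamma> s t \<in> graph_curve (a t) (b t) (\<lambda>x. v x t)" using range[of t] that \<delta> by auto
      then show ?thesis using a[OF that] abs_e[of "\<gamma> s t $ 1"] by (auto simp: graph_curve_def open_region_def)
    qed
    note iso = mirror_isometry[OF e(1)]
    have cf': "curve_family {0<..<\<delta>} (\<lambda>s t. mirror e (\<gamma> s t)) (\<lambda>s t. mirror e (\<gamma>s s t))
        (\<lambda>s t. mirror e (\<gamma>ss s t)) (\<lambda>s t. mirror e (\<gamma>t s t))"
    proof (rule curve_family_mirror)
      have "UNIV \<times> {0<..<\<delta>} \<subseteq> (UNIV :: real set) \<times> {0<..<T}" using \<delta> by auto
      then show "curve_family {0<..<\<delta>} \<gamma> \<gamma>s \<gamma>ss \<gamma>t"
        using cf \<delta> unfolding curve_family_def by (auto intro: continuous_on_subset)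
    qed
    have lin: "mirror e (x - y) = mirror e x - mirror e y" "mirror e (r *\<^sub>R x) = r *\<^sub>R mirror e x"
      "mirror e (x + y) = mirror e x + mirror e y" for x y r
      by (simp_all add: vec_eq_iff forall_2 algebra_simps)
    define R where "R = mirror e x0 - \<gamma> \<sigma> t0"
    have R: "x0 - mirror e (\<gamma> \<sigma> t0) = mirror e R" by (simp add: R_def lin iso)
    have x0q0: "x0 - q0 = mirror e R" using R \<sigma> by (simp add: iso)
    show False
    proof (rule curve_no_touching[OF sub cf' t0 \<eta> C, of \<sigma> x0])
      show "mirror e (\<gamma>s \<sigma> t0) \<noteq> 0" using nz[OF t0T, of \<sigma>] iso(3)[of "\<gamma>s \<sigma> t0"] by auto
      have "\<forall>\<^sub>F z in nhds (x0, t0). z \<in> UNIV \<times> {0<..<\<delta>}"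
        using t0 by (intro eventually_nhds_in_open open_Times) auto
      then show "\<forall>\<^sub>F z in nhds (x0, t0). \<forall>s.
        \<psi> (fst z) (snd z) - C * norm (fst z - mirror e (\<gamma> s (snd z))) ^ 4 - \<eta> / (\<delta> - snd z)
          \<le> \<psi> x0 t0 - C * norm (x0 - mirror e (\<gamma> \<sigma> t0)) ^ 4 - \<eta> / (\<delta> - t0)"
        by (rule eventually_mono) (use max on_curve \<sigma> in \<open>auto simp: iso\<close>)
      show "x0 = mirror e (\<gamma> \<sigma> t0) \<or> (x0 - mirror e (\<gamma> \<sigma> t0)) \<bullet> mirror e (\<gamma>s \<sigma> t0) = 0 \<and>
        - ((x0 - mirror e (\<gamma> \<sigma> t0)) \<bullet> mirror e (\<gamma>ss \<sigma> t0)) / (norm (mirror e (\<gamma>s \<sigma> t0)))\<^sup>2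
          + A * norm (x0 - mirror e (\<gamma> \<sigma> t0)) \<le> - ((x0 - mirror e (\<gamma> \<sigma> t0)) \<bullet> mirror e (\<gamma>t \<sigma> t0))"
      proof (cases "x0 = q0")
        case False
        have Rnz: "R \<noteq> 0" using False x0q0 iso(3)[of R] by auto
        \<comment> \<open>First-order condition for \<sigma>, which minimises the distance from the
          reflected \<open>x0\<close> to the curve.\<close>
        have perp: "R \<bullet> \<gamma>s \<sigma> t0 = 0"
        proof -
          have d: "((\<lambda>s. \<gamma> s t0) has_derivative (\<lambda>h. h *\<^sub>R \<gamma>s \<sigma> t0)) (at \<sigma>)"
            using cf t0T by (auto simp: curve_family_def has_vector_derivative_def)
          have "((\<lambda>s. (mirror e x0 - \<gamma> s t0) \<bullet> (mirror e x0 - \<gamma> s t0)) has_derivative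
              (\<lambda>h. (- 2 * (R \<bullet> \<gamma>s \<sigma> t0)) * h)) (at \<sigma>)"
            unfolding R_def
            by (rule has_derivative_eq_rhs[OF has_derivative_inner[OF has_derivative_diff[OF has_derivative_const d]
                  has_derivative_diff[OF has_derivative_const d]]])
              (simp add: fun_eq_iff inner_commute algebra_simps)
          then have "((\<lambda>s. (mirror e x0 - \<gamma> s t0) \<bullet> (mirror e x0 - \<gamma> s t0)) has_real_derivative
              - 2 * (R \<bullet> \<gamma>s \<sigma> t0)) (at \<sigma>)"
            unfolding has_field_derivative_def .
          moreover have "(mirror e x0 - \<gamma> \<sigma> t0) \<bullet> (mirror e x0 - \<gamma> \<sigma> t0)
              \<le> (mirror e x0 - \<gamma> s t0) \<bullet> (mirror e x0 - \<gamma> s t0)" for s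
          proof -
            have "norm (mirror e (mirror e x0 - \<gamma> \<sigma> t0)) \<le> norm (mirror e (mirror e x0 - \<gamma> s t0))"
              using closest[OF on_curve[OF t0, of s]] \<sigma> by (simp add: lin iso(2))
            then show ?thesis by (simp add: iso(3) norm_le)
          qed
          ultimately have "- 2 * (R \<bullet> \<gamma>s \<sigma> t0) = 0"
            by (intro DERIV_local_min[of _ _ _ 1]) auto
          then show ?thesis by simp
        qed
        obtain n where n: "outer_normal (graph_curve (a t0) (b t0) (\<lambda>x. v x t0)) (\<gamma> \<sigma> t0) (\<gamma>s \<sigma> t0) n"
          and vel: "\<gamma>t \<sigma> t0 \<bullet> n = (\<gamma>ss \<sigma> t0 \<bullet> n) / (norm (\<gamma>s \<sigma> t0))\<^sup>2 + A"
          using normal[OF t0T] by blast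
        have n1: "norm n = 1" "n \<bullet> \<gamma>s \<sigma> t0 = 0"
          and out: "\<forall>\<^sub>F l in at_right 0. \<gamma> \<sigma> t0 + l *\<^sub>R n \<in> outside (graph_curve (a t0) (b t0) (\<lambda>x. v x t0))"
          using n by (auto simp: outer_normal_def)
        define c where "c = R \<bullet> n"
        have Rn: "R = c *\<^sub>R n" using orthogonal_real2[OF nz[OF t0T] perp n1(2,1)] by (simp add: c_def)
        \<comment> \<open>Were c > 0, short steps along the outer normal would run along the segment
          towards \<open>x0\<close>, hence inside the region, contrary to
          \<open>graph_curve_inside\<close>.\<close>
        have "c \<le> 0"
        proof (rule ccontr)
          assume "\<not> c \<le> 0"
          then have c: "0 < c" by simp
          have "\<forall>\<^sub>F l in at_right (0::real). 0 < l \<and> l < c"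
            unfolding eventually_at_right_field using c by auto
          with out have "\<forall>\<^sub>F l in at_right (0::real). False"
          proof eventually_elim
            case (elim l)
            define m where "m = l / c"
            have m: "0 < m" "m \<le> 1" using elim c by (simp_all add: m_def)
            define p where "p = \<gamma> \<sigma> t0 + l *\<^sub>R n"
            have p: "p = \<gamma> \<sigma> t0 + m *\<^sub>R R" using c by (simp add: p_def Rn m_def)
            have "mirror e p = q0 + m *\<^sub>R (x0 - q0)"
              by (simp add: p lin \<sigma> iso x0q0)
            then have "mirror e p \<in> open_region a b v t0" using between[OF m False] by simp
            moreover have "p $ 1 = (1 - m) * (e * q0 $ 1) + m * (e * x0 $ 1)"
              by (simp add: p R_def \<sigma> algebra_simps)
            then have "0 < p $ 1"
              using q0_side x0_side[OF False] m by (simp add: add_nonneg_pos)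
            ultimately have "a t0 < p $ 1" "p $ 1 < b t0" "\<bar>p $ 2\<bar> < v (p $ 1) t0"
              using abs_e[of "p $ 1"] by (auto simp: open_region_def)
            from graph_curve_inside[OF cv v(2,3,1) this] elim show False by (simp add: p_def)
          qed
          then show False by simp
        qed
        then have c: "norm R = - c" using n1 by (simp add: Rn)
        \<comment> \<open>Since R = - |R| n, the required inequality is |R| times the law of motion
          at the foot point and holds with equality.\<close>
        have "- (R \<bullet> \<gamma>ss \<sigma> t0) / (norm (\<gamma>s \<sigma> t0))\<^sup>2 + A * norm R
            = - c * ((\<gamma>ss \<sigma> t0 \<bullet> n) / (norm (\<gamma>s \<sigma> t0))\<^sup>2 + A)"
          unfolding c by (simp add: Rn inner_commute algebra_simps)
        also have "\<dots> = - (R \<bullet> \<gamma>t \<sigma> t0)" unfolding vel[symmetric] by (simp add: Rn inner_commute)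
        finally show ?thesis using perp unfolding R by (simp add: iso)
      qed (simp add: \<sigma> iso)
    qed
  qed
qed

section \<open>Initial bounds and comparison outside the enclosed region\<close>

lemma bounded_D_init:
  assumes "initial_profile b0 u0"
  shows "bounded (D_init b0 u0)"
proof -
  have "compact (u0 ` {0..b0})"
    using assms by (intro compact_continuous_image) (auto simp: initial_profile_def)
  then obtain B where B: "\<forall>y\<in>u0 ` {0..b0}. norm y \<le> B"
    using compact_imp_bounded bounded_iff by blast
  have "norm w \<le> b0 + B" if "w \<in> D_init b0 u0" for w
  proof -
    have "norm w \<le> \<bar>w $ 1\<bar> + \<bar>w $ 2\<bar>" using norm_le_l1_cart[of w] by (simp add: sum_2)
    moreover have w: "\<bar>w $ 1\<bar> \<le> b0" "\<bar>w $ 2\<bar> < u0 \<bar>w $ 1\<bar>" using that by (auto simp: D_init_def)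
    then have "norm (u0 \<bar>w $ 1\<bar>) \<le> B" by (intro B[rule_format, OF imageI]) auto
    ultimately show ?thesis using w by simp
  qed
  then show ?thesis by (rule boundedI)
qed

lemma D_init_eq:
  assumes "initial_profile b0 u0" "free_planar_flow A b0 u0 T v a b"
  shows "D_init b0 u0 = open_region a b v 0"
proof -
  have u: "u0 0 = 0" "u0 b0 = 0" and ab: "a 0 = 0" "b 0 = b0" and v: "\<And>x. x \<in> {0..b0} \<Longrightarrow> v x 0 = u0 x"
    using assms by (auto simp: initial_profile_def free_planar_flow_def)
  show ?thesis
  proof (intro set_eqI iffI)
    fix z assume "z \<in> D_init b0 u0"
    then have z: "\<bar>z $ 1\<bar> \<le> b0" "\<bar>z $ 2\<bar> < u0 \<bar>z $ 1\<bar>" by (auto simp: D_init_def)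
    then have "\<bar>z $ 1\<bar> \<noteq> 0" "\<bar>z $ 1\<bar> \<noteq> b0" using u by auto
    with z show "z \<in> open_region a b v 0" using v[of "\<bar>z $ 1\<bar>"] ab by (auto simp: open_region_def)
  next
    fix z assume "z \<in> open_region a b v 0"
    then show "z \<in> D_init b0 u0"
      using v[of "\<bar>z $ 1\<bar>"] ab by (auto simp: open_region_def D_init_def)
  qed
qed

lemma viscosity_solution_bound:
  assumes "viscosity_solution A \<psi>"
  obtains M where "\<And>x t. t \<in> {0..S} \<Longrightarrow> \<bar>\<psi> x t\<bar> \<le> M"
proof -
  have "bounded ((\<lambda>z. \<psi> (fst z) (snd z)) ` (UNIV \<times> {0..S}))"
    using assms by (auto simp: viscosity_solution_def)
  then obtain M where M: "\<forall>y\<in>(\<lambda>z. \<psi> (fst z) (snd z)) ` (UNIV \<times> {0..S}). norm y \<le> M"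
    unfolding bounded_iff by blast
  show thesis
  proof (rule that)
    show "\<bar>\<psi> x t\<bar> \<le> M" if "t \<in> {0..S}" for x t
      using M that by (force simp: image_iff)
  qed
qed

lemma subsolution_nonpos_far:
  fixes \<psi> :: "real^2 \<Rightarrow> real \<Rightarrow> real"
  assumes sub: "viscosity_subsolution A \<psi>"
    and cont: "continuous_on (UNIV \<times> {0..}) (\<lambda>z. \<psi> (fst z) (snd z))"
    and bound: "\<And>x t. t \<in> {0..\<tau>} \<Longrightarrow> \<psi> x t \<le> M"
    and D: "bounded {x. \<psi> x 0 > 0}"
  obtains R where "\<And>x t. R < norm x \<Longrightarrow> t \<in> {0..<\<tau>} \<Longrightarrow> \<psi> x t \<le> 0"
proof (cases "0 \<le> \<tau>")
  case True
  obtain R0 where R0: "\<And>x. 0 < \<psi> x 0 \<Longrightarrow> norm x \<le> R0"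
    using D unfolding bounded_iff by blast
  \<comment> \<open>The bounds r >= 16 |A| \<tau> and r^2 >= 16 \<tau> make each of 2 |A| r \<tau>
    and 2 \<tau> at most r^2 / 8, as \<open>subsolution_nonpos_in_ball\<close> requires.\<close>
  define r where "r = 16 * (\<bar>A\<bar> * \<tau>) + 4 * \<tau> + 4"
  have Ap: "0 \<le> \<bar>A\<bar> * \<tau>" using True by simp
  have r: "0 < r" using Ap True unfolding r_def by linarith
  have "(4 + 4 * \<tau>) * 4 \<le> r * r"
    using Ap True by (intro mult_mono) (auto simp: r_def)
  then have 1: "16 * \<tau> \<le> r * r" by simp
  have 2: "16 * (\<bar>A\<bar> * \<tau>) * r \<le> r * r"
    using r True by (intro mult_right_mono) (auto simp: r_def)
  have \<tau>: "(2 + 2 * \<bar>A\<bar> * r) * \<tau> \<le> (r / 2)\<^sup>2"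
    using 1 2 by (simp add: power2_eq_square algebra_simps)
  show thesis
  proof (rule that[of "R0 + r"])
    fix x :: "real^2" and t assume x: "R0 + r < norm x" and t: "t \<in> {0..<\<tau>}"
    have "\<psi> y 0 \<le> 0" if "y \<in> cball x r" for y
    proof -
      have "norm x - norm y \<le> r" using that norm_triangle_ineq2[of x y] by (simp add: dist_norm)
      then show ?thesis using R0[of y] x by linarith
    qed
    from subsolution_nonpos_in_ball[OF sub cont bound r this \<tau> t] show "\<psi> x t \<le> 0" by auto
  qed
qed (use that in auto)

text \<open>A positive value at \<open>z1\<close> makes the penalised function \<open>\<Phi>\<close>
  positive at (z1, z1, t1). The constants ensure that its maximum is attained, and at a positive
  time, which \<open>no_global_max\<close> forbids.\<close>

lemma subsolution_nonpos_outside_flow: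
  fixes \<psi> :: "real^2 \<Rightarrow> real \<Rightarrow> real"
  assumes vis: "viscosity_solution A \<psi>" and D0: "D_init b0 u0 = {x. \<psi> x 0 > 0}"
    and ip: "initial_profile b0 u0" and flow: "free_planar_flow A b0 u0 T v a b"
    and \<delta>: "0 < \<delta>" "\<delta> \<le> T" and a: "\<And>t. t \<in> {0<..<\<delta>} \<Longrightarrow> 0 \<le> a t"
    and t1: "t1 \<in> {0<..<\<delta>}" and z1: "z1 \<notin> open_region a b v t1"
  shows "\<psi> z1 t1 \<le> 0"
proof (rule ccontr)
  assume "\<not> \<psi> z1 t1 \<le> 0"
  then have pos: "0 < \<psi> z1 t1" by simp
  have sub: "viscosity_subsolution A \<psi>"
    and cont: "continuous_on (UNIV \<times> {0..}) (\<lambda>z. \<psi> (fst z) (snd z))"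
    using vis by (auto simp: viscosity_solution_def)
  obtain M where M: "\<And>x t. t \<in> {0..\<delta>} \<Longrightarrow> \<bar>\<psi> x t\<bar> \<le> M"
    using viscosity_solution_bound[OF vis] by blast
  have O0: "open_region a b v 0 = {x. \<psi> x 0 > 0}"
    using D_init_eq[OF ip flow] D0 by simp
  have bD: "bounded {x. \<psi> x 0 > 0}" using bounded_D_init[OF ip] D0 by simp
  obtain R where R: "\<And>x t. R < norm x \<Longrightarrow> t \<in> {0..<\<delta>} \<Longrightarrow> \<psi> x t \<le> 0"
    using subsolution_nonpos_far[OF sub cont _ bD, of \<delta> M] M by (meson abs_le_D1)
  define \<eta> where "\<eta> = \<psi> z1 t1 * (\<delta> - t1) / 2"
  have \<eta>: "0 < \<eta>" using pos t1 by (simp add: \<eta>_def)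
  define N where "N = max 1 M"
  have N: "1 \<le> N" "M \<le> N" by (auto simp: N_def)
  define \<beta> where "\<beta> = \<eta> / N"
  have \<beta>: "0 < \<beta>" using \<eta> N by (simp add: \<beta>_def)
  define t' where "t' = \<delta> - \<beta>"
  have t': "t' < T" "t' < \<delta>" using \<beta> \<delta> by (auto simp: t'_def)
  let ?Cl = "{w. snd w \<in> {0..t'} \<and> fst w \<notin> open_region a b v (snd w)}"
  have Cl: "closed ?Cl"
    by (rule closed_regions(2)[OF free_planar_flow_continuous[OF flow t'(1)]])
  have cont0: "continuous_on UNIV (\<lambda>x. \<psi> x 0)"
    using vis by (intro uniformly_continuous_imp_continuous) (simp add: viscosity_solution_def)
  \<comment> \<open>At time 0 the penalty is \<eta> / \<delta>, so positivity of
    \<open>\<Phi>\<close> would force x into \<open>?K\<close>. This compact part of the initial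
    open set keeps a distance \<rho> > 0 from the complement, where q lies.\<close>
  let ?K = "{x. \<eta> / \<delta> \<le> \<psi> x 0}"
  have "closed ?K" by (intro closed_Collect_le cont0 continuous_intros)
  moreover have KD: "?K \<subseteq> {x. \<psi> x 0 > 0}"
  proof
    fix x assume "x \<in> ?K"
    moreover have "0 < \<eta> / \<delta>" using \<eta> \<delta> by simp
    ultimately show "x \<in> {x. \<psi> x 0 > 0}" by simp
  qed
  then have "bounded ?K" by (rule bounded_subset[OF bD])
  ultimately have "compact ?K" using compact_eq_bounded_closed by blast
  moreover have "closed (- {x. \<psi> x 0 > 0})"
    unfolding closed_def double_complement by (intro open_Collect_less cont0 continuous_intros)
  moreover have "?K \<inter> - {x. \<psi> x 0 > 0} = {}" using KD by blast
  ultimately obtain \<rho> where \<rho>: "0 < \<rho>" "\<And>x y. x \<in> ?K \<Longrightarrow> \<not> \<psi> y 0 > 0 \<Longrightarrow> \<rho> \<le> dist x y"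
    using separate_compact_closed[of ?K "- {x. \<psi> x 0 > 0}"] by auto
  \<comment> \<open>The quartic term now reaches the bound \<open>N\<close> of \<psi> once |x - q|
    >= \<rho>, so a positive maximum has x and q closer than \<rho>.\<close>
  define C where "C = N / \<rho> ^ 4"
  have C: "0 < C" using N \<rho> by (simp add: C_def)
  define \<Phi> where "\<Phi> x q s = \<psi> x s - C * norm (x - q) ^ 4 - \<eta> / (\<delta> - s)" for x q s
  have far: "\<Phi> x q s \<le> 0" if "\<rho> \<le> norm (x - q)" "s \<in> {0..<\<delta>}" for x q s
  proof -
    have "C * \<rho> ^ 4 \<le> C * norm (x - q) ^ 4"
      using that \<rho> C by (intro mult_left_mono power_mono) auto
    then have "N \<le> C * norm (x - q) ^ 4" using \<rho> by (simp add: C_def)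
    moreover have "0 < \<eta> / (\<delta> - s)" using \<eta> that by simp
    moreover have "\<psi> x s \<le> M" using M[of s x] that by auto
    ultimately show ?thesis using N by (simp add: \<Phi>_def)
  qed
  have nonneg: "0 \<le> C * norm (x - q) ^ 4" for x q :: "real^2" using C by simp
  have late: "\<Phi> x q s \<le> 0" if "t' \<le> s" "s < \<delta>" "0 \<le> s" for x q s
  proof -
    have "N \<le> \<eta> / (\<delta> - s)" using that N \<eta> by (simp add: t'_def \<beta>_def field_simps)
    moreover have "\<psi> x s \<le> M" using M[of s x] that by auto
    ultimately show ?thesis using N nonneg[of x q] by (simp add: \<Phi>_def)
  qed
  have start: "0 < \<Phi> z1 z1 t1"
  proof -
    have "\<eta> / (\<delta> - t1) = \<psi> z1 t1 / 2" using t1 by (simp add: \<eta>_def field_simps)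
    then show ?thesis using pos by (simp add: \<Phi>_def)
  qed
  let ?S = "(cball 0 R :: (real^2) set) \<times> (cball 0 (R + \<rho>) \<times> {0..t'} \<inter> ?Cl)"
  have outside: "\<Phi> x q s \<le> 0" if "s \<in> {0..<\<delta>}" "q \<notin> open_region a b v s" "(x, q, s) \<notin> ?S" for x q s
  proof (cases "R < norm x")
    case True
    then have "\<psi> x s \<le> 0" using R that by blast
    moreover have "0 < \<eta> / (\<delta> - s)" using \<eta> that by simp
    ultimately show ?thesis using nonneg[of x q] by (simp add: \<Phi>_def)
  next
    case False
    then have "\<rho> \<le> norm (x - q) \<or> t' \<le> s"
      using that norm_triangle_ineq2[of q x] by (auto simp: not_le norm_minus_commute)
    then show ?thesis using far[of x q s] late[of s x q] that by auto
  qed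
  have in_S: "(z1, z1, t1) \<in> ?S" using outside[of t1 z1 z1] start t1 z1 by (meson atLeastLessThan_iff greaterThanLessThan_iff less_imp_le not_le)
  moreover have "compact ?S" using Cl by (intro compact_Times compact_Int_closed) auto
  moreover have "continuous_on ?S (\<lambda>w. \<Phi> (fst w) (fst (snd w)) (snd (snd w)))"
    unfolding \<Phi>_def using t'
    by (intro continuous_intros continuous_on_compose2[OF cont, of _ "\<lambda>w. (fst w, snd (snd w))", simplified]) auto
  ultimately obtain w where w: "w \<in> ?S"
    "\<And>y. y \<in> ?S \<Longrightarrow> \<Phi> (fst y) (fst (snd y)) (snd (snd y)) \<le> \<Phi> (fst w) (fst (snd w)) (snd (snd w))"
    using continuous_attains_sup[of ?S "\<lambda>w. \<Phi> (fst w) (fst (snd w)) (snd (snd w))"] by blast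
  obtain x0 q0 t0 where w_eq: "w = (x0, q0, t0)" by (cases w) auto
  have m: "0 < \<Phi> x0 q0 t0" using w(2)[OF in_S] start by (simp add: w_eq)
  have q0: "q0 \<notin> open_region a b v t0" and t0: "0 \<le> t0" "t0 < \<delta>"
    using w(1) t' by (simp_all add: w_eq)
  have max: "\<Phi> x q s \<le> \<Phi> x0 q0 t0" if "s \<in> {0..<\<delta>}" "q \<notin> open_region a b v s" for x q s
  proof (cases "(x, q, s) \<in> ?S")
    case True
    from w(2)[OF this] show ?thesis unfolding w_eq fst_conv snd_conv .
  next
    case False
    from outside[OF that this] m show ?thesis by linarith
  qed
  have "t0 \<noteq> 0"
  proof
    assume "t0 = 0"
    have "\<not> \<rho> \<le> norm (x0 - q0)" using far[of x0 q0 t0] m t0 by auto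
    then have "x0 \<notin> ?K" using \<rho>(2)[of x0 q0] q0 O0 \<open>t0 = 0\<close> by (auto simp: dist_norm)
    then show False using m nonneg[of x0 q0] \<open>t0 = 0\<close> by (simp add: \<Phi>_def)
  qed
  then show False
    using no_global_max[OF sub flow \<delta> a C \<eta>, of t0 q0 x0] max q0 t0 by (simp add: \<Phi>_def)
qed

text \<open>The vertical tangent at the origin puts a cone of slope 4 into the initial set. The
  excess over slope 1 leaves room for discs around the sides |x| = h, which supply the lateral
  condition when \<open>subsolution_nonpos_in_cone\<close> is applied to - \<psi>.\<close>

lemma supersolution_nonneg_near_origin:
  assumes vis: "viscosity_solution A \<psi>" and E0: "E_init b0 u0 = {x. \<psi> x 0 \<ge> 0}"
    and ip: "initial_profile b0 u0" and A: "0 < A"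
  obtains \<tau> h where "0 < \<tau>" "0 < h"
    "\<And>z t. t \<in> {0<..<\<tau>} \<Longrightarrow> (z $ 2)\<^sup>2 \<le> (z $ 1)\<^sup>2 + A * (t * sqrt t) \<Longrightarrow> \<bar>z $ 1\<bar> \<le> h \<Longrightarrow>
      \<bar>z $ 2\<bar> \<le> 2 * h \<Longrightarrow> 0 \<le> \<psi> z t"
proof -
  have u0: "u0 0 = 0" and b0: "0 < b0"
    and "filterlim (\<lambda>x. (u0 x - u0 0) / (x - 0)) at_top (at_right 0)"
    using ip by (auto simp: initial_profile_def vertical_ends_def)
  then have "\<forall>\<^sub>F x in at_right 0. 4 \<le> u0 x / x"
    by (simp add: filterlim_at_top)
  then obtain d where d: "0 < d" "\<And>x. 0 < x \<Longrightarrow> x < d \<Longrightarrow> 4 \<le> u0 x / x"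
    unfolding eventually_at_right_field by auto
  define h where "h = min d b0 / 2"
  have h: "0 < h" "2 * h \<le> d" "2 * h \<le> b0" using d b0 by (auto simp: h_def)
  have steep: "4 * x \<le> u0 x" if "0 \<le> x" "x < 2 * h" for x
  proof (cases "x = 0")
    case False
    then have "4 \<le> u0 x / x" "0 < x" using d(2)[of x] that h by auto
    then show ?thesis by (simp add: field_simps)
  qed (simp add: u0)
  have init: "- \<psi> z 0 \<le> 0" if "\<bar>z $ 2\<bar> \<le> 4 * \<bar>z $ 1\<bar>" "\<bar>z $ 1\<bar> < 2 * h" for z
  proof -
    have "z \<in> E_init b0 u0"
      unfolding E_init_eq[OF ip] using steep[of "\<bar>z $ 1\<bar>"] that h by auto
    then show ?thesis using E0 by auto
  qed
  have sub: "viscosity_subsolution (- A) (\<lambda>x t. - \<psi> x t)"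
    using vis by (intro viscosity_supersolution_uminus) (auto simp: viscosity_solution_def)
  have cont: "continuous_on (UNIV \<times> {0..}) (\<lambda>z. - \<psi> (fst z) (snd z))"
    using vis by (intro continuous_intros) (auto simp: viscosity_solution_def)
  obtain M where M: "\<And>x t. t \<in> {0..1} \<Longrightarrow> \<bar>\<psi> x t\<bar> \<le> M"
    using viscosity_solution_bound[OF vis] by blast
  \<comment> \<open>Discs of radius h / 4 about points with |x| = h and |y| <= 3/2 h keep |x| >= 3/4
    h and |y| <= 7/4 h, hence stay in the cone of slope 4.\<close>
  define r where "r = h / 4"
  \<comment> \<open>The three entries secure the bound \<open>M\<close>, the lifetime of the discs
    and, together with \<tau> <= 1, the inequality A \<tau>^(3/2) <= h^2 / 4.\<close>
  define \<tau> where "\<tau> = Min {1, (r / 2)\<^sup>2 / (2 + 2 * A * r), h\<^sup>2 / (4 * A)}"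
  have r: "0 < r" using h by (simp add: r_def)
  have L: "0 < 2 + 2 * A * r" using A r by (simp add: add_pos_pos)
  have \<tau>: "0 < \<tau>" "\<tau> \<le> 1" "\<tau> \<le> (r / 2)\<^sup>2 / (2 + 2 * A * r)" "\<tau> \<le> h\<^sup>2 / (4 * A)"
    using A r h L by (auto simp: \<tau>_def)
  have bound: "- \<psi> x t \<le> M" if "t \<in> {0..\<tau>}" for x t using M[of t x] that \<tau> by auto
  have \<tau>r: "(2 + 2 * \<bar>- A\<bar> * r) * \<tau> \<le> (r / 2)\<^sup>2"
    using \<tau>(3) L A by (simp add: pos_le_divide_eq mult.commute)
  have lateral: "- \<psi> x t \<le> 0" if x: "\<bar>x $ 1\<bar> = h" "\<bar>x $ 2\<bar> \<le> 3 / 2 * h" and t: "t \<in> {0..<\<tau>}" for x t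
  proof (rule subsolution_nonpos_in_ball[OF sub cont bound r _ \<tau>r t])
    fix y assume "y \<in> cball x r"
    then have "norm (x - y) \<le> r" by (simp add: dist_norm)
    then have "\<bar>x $ 1 - y $ 1\<bar> \<le> r" "\<bar>x $ 2 - y $ 2\<bar> \<le> r"
      using component_le_norm_cart[of "x - y" 1] component_le_norm_cart[of "x - y" 2] by auto
    then have "\<bar>y $ 2\<bar> \<le> 4 * \<bar>y $ 1\<bar>" "\<bar>y $ 1\<bar> < 2 * h"
      using x h(1) unfolding r_def by linarith+
    then show "- \<psi> y 0 \<le> 0" by (rule init)
  qed
  have small: "A * (\<tau> * sqrt \<tau>) \<le> h\<^sup>2 / 4"
  proof -
    have "\<tau> * sqrt \<tau> \<le> \<tau> * 1" using \<tau> by (intro mult_left_mono) auto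
    also have "\<dots> \<le> h\<^sup>2 / (4 * A)" using \<tau> by simp
    finally show ?thesis using A by (simp add: field_simps)
  qed
  show thesis
  proof (rule that[OF \<tau>(1) h(1)])
    fix z :: "real^2" and t
    assume t: "t \<in> {0<..<\<tau>}"
      and z: "(z $ 2)\<^sup>2 \<le> (z $ 1)\<^sup>2 + A * (t * sqrt t)" "\<bar>z $ 1\<bar> \<le> h" "\<bar>z $ 2\<bar> \<le> 2 * h"
    have "- \<psi> z t \<le> 0"
      by (rule subsolution_nonpos_in_cone[OF sub A cont bound h(1) _ lateral small _ z])
        (use t h in \<open>auto intro!: init[simplified]\<close>)
    then show "0 \<le> \<psi> z t" by simp
  qed
qed

section \<open>Fattening near the origin\<close>

theorem theorem1p4:
  fixes A b0 T :: real
    and u0 a_star b_star :: "real \<Rightarrow> real"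
    and v :: "real \<Rightarrow> real \<Rightarrow> real"
    and \<Gamma> :: "real \<Rightarrow> (real^2) set"
  assumes "A > 0"
    and "initial_profile b0 u0"
    and "free_planar_flow A b0 u0 T v a_star b_star"
    and "\<exists>\<delta>>0. \<delta> \<le> T \<and> (\<forall>t\<in>{0<..<\<delta>}. a_star t \<ge> 0)"
    and "interface_evolution A (D_init b0 u0) (E_init b0 u0) \<Gamma>"
  shows "fattening \<Gamma>"
proof -
  obtain D E where oe: "open_evolution A (D_init b0 u0) D" and ce: "closed_evolution A (E_init b0 u0) E"
    and \<Gamma>: "\<And>t. 0 \<le> t \<Longrightarrow> \<Gamma> t = E t - D t"
    using assms(5) unfolding interface_evolution_def by blast
  obtain \<psi> where \<psi>: "viscosity_solution A \<psi>" "D_init b0 u0 = {x. \<psi> x 0 > 0}"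
    and D: "\<And>t. 0 \<le> t \<Longrightarrow> D t = {x. \<psi> x t > 0}"
    using oe unfolding open_evolution_def by blast
  obtain \<zeta> where \<zeta>: "viscosity_solution A \<zeta>" "E_init b0 u0 = {x. \<zeta> x 0 \<ge> 0}"
    and E: "\<And>t. 0 \<le> t \<Longrightarrow> E t = {x. \<zeta> x t \<ge> 0}"
    using ce unfolding closed_evolution_def by blast
  obtain \<delta> where \<delta>: "0 < \<delta>" "\<delta> \<le> T" "\<And>t. t \<in> {0<..<\<delta>} \<Longrightarrow> 0 \<le> a_star t"
    using assms(4) by blast
  obtain \<tau> h where \<tau>: "0 < \<tau>" and h: "0 < h"
    and opened: "\<And>z t. t \<in> {0<..<\<tau>} \<Longrightarrow> (z $ 2)\<^sup>2 \<le> (z $ 1)\<^sup>2 + A * (t * sqrt t) \<Longrightarrow> \<bar>z $ 1\<bar> \<le> h \<Longrightarrow>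
      \<bar>z $ 2\<bar> \<le> 2 * h \<Longrightarrow> 0 \<le> \<zeta> z t"
    using supersolution_nonneg_near_origin[OF \<zeta> assms(2,1)] by blast
  define t where "t = min \<delta> \<tau> / 2"
  have t: "t \<in> {0<..<\<delta>}" "t \<in> {0<..<\<tau>}" "0 < t" "t < T" using \<delta> \<tau> by (auto simp: t_def)
  \<comment> \<open>The hyperbola bounding the barrier meets the axis at height \<open>s\<close>, so
    the rectangle \<open>?W\<close> lies in \<open>E t\<close>.\<close>
  define s where "s = sqrt (A * (t * sqrt t))"
  have s: "0 < s" "s\<^sup>2 = A * (t * sqrt t)" using t assms(1) by (simp_all add: s_def)
  let ?W = "{z :: real^2. \<bar>z $ 1\<bar> < h \<and> \<bar>z $ 2\<bar> < min s h}"
  define p :: "real^2" where "p = vector [0, min s h / 2]"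
  have "open ?W"
    by (intro open_Collect_conj open_Collect_less continuous_intros)
  moreover have "open (- closed_region a_star b_star v t)"
  proof -
    let ?C = "{w. snd w \<in> {0..t} \<and> fst w \<in> closed_region a_star b_star v (snd w)}"
    have "closed ?C" by (rule closed_regions(1)[OF free_planar_flow_continuous[OF assms(3) t(4)]])
    then have "closed ((\<lambda>z. (z, t)) -` ?C)"
      by (intro continuous_closed_vimage continuous_intros)
    also have "(\<lambda>z. (z, t)) -` ?C = closed_region a_star b_star v t" using t by auto
    finally show ?thesis by (simp add: open_Compl)
  qed
  ultimately have "open (?W \<inter> - closed_region a_star b_star v t)" by (rule open_Int)
  moreover have "p \<in> ?W \<inter> - closed_region a_star b_star v t"
  proof -
    \<comment> \<open>The point \<open>p\<close> is on the axis at positive height. The closed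
      region misses the axis if a_star t > 0, and meets it only in the origin if a_star t =
      0.\<close>
    have "v (a_star t) t = 0" using assms(3) t by (simp add: free_planar_flow_def)
    then show ?thesis using \<delta>(3)[OF t(1)] s h by (auto simp: p_def closed_region_def)
  qed
  moreover have "?W \<inter> - closed_region a_star b_star v t \<subseteq> \<Gamma> t"
  proof
    fix z assume z: "z \<in> ?W \<inter> - closed_region a_star b_star v t"
    then have "z \<notin> open_region a_star b_star v t"
      by (auto simp: open_region_def closed_region_def)
    from subsolution_nonpos_outside_flow[OF \<psi> assms(2,3) \<delta> t(1) this] have "z \<notin> D t"
      using D t by simp
    moreover have "\<bar>z $ 2\<bar> \<le> \<bar>s\<bar>" using z s by auto
    then have "(z $ 2)\<^sup>2 \<le> s\<^sup>2" by (simp add: abs_le_square_iff)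
    then have "(z $ 2)\<^sup>2 \<le> (z $ 1)\<^sup>2 + A * (t * sqrt t)" using s by (simp add: add_increasing)
    then have "0 \<le> \<zeta> z t" using z h by (intro opened t) auto
    then have "z \<in> E t" using E t by simp
    ultimately show "z \<in> \<Gamma> t" using \<Gamma> t by simp
  qed
  ultimately have "p \<in> interior (\<Gamma> t)" by (rule interiorI)
  then show ?thesis unfolding fattening_def using t by (intro exI[of _ t]) auto
qed

end
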